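(* Let $X_0\in\mathbb{R}^{2n}$ be fixed and let $\phi=(\phi_1,\phi_2)^\top$, with $\phi_1,\phi_2\in\mathbb{R}^n$, be the global solution of the Liouville equation $\mathcal{L}[\phi(t,X)]=0$ with initial condition $\phi(0,X)=X-X_0$. For $k_1,k_2\in\mathbb{C}$ set $g:=k_1\phi_1+k_2\phi_2$. Then: (a) $\mathcal{L}(k_1\phi_1+k_2\phi_2)=0$ for any $k_1,k_2\in\mathbb{C}$. (b) If ${\rm Im}(\bar k_1k_2)\ne0$, then $g_p$ is invertible for all $t>0$. (c) Suppose ${\rm Im}(\bar k_1k_2)\ne0$. If $M_{\rm in}=-g_x(g_p)^{-1}|_{t=0}$, then the solution $\tilde M$ of $$\mathcal{L}(\tilde M)+H_{xx}+H_{xp}\tilde M+\tilde MH_{px}+\tilde MH_{pp}\tilde M=0,\qquad \tilde M(0,X)=M_{\rm in}(X),\qquad ( * )$$ is $\tilde M=-g_x(g_p)^{-1}$ for all $t>0$. (d) The matrix $\tilde M$ in (c) satisfies $( * )$ and $\tilde M=\tilde M^\top$. If moreover ${\rm Im}(k_1/k_2)<0$, then ${\rm Im}(\tilde M)$ is positive definite for all $t>0$.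
   Context: $H=H(x,p)$ is a smooth real-valued Hamiltonian on $\mathbb{R}^n\times\mathbb{R}^n$, $X=(x,p)$, $V=(H_p,-H_x)$, and $\mathcal{L}=\partial_t+V\cdot\nabla_X=\partial_t+H_p\cdot\nabla_x-H_x\cdot\nabla_p$ is the Liouville operator (acting entrywise on vectors and matrices). $\phi_1$ and $\phi_2$ are the first and last $n$ components of $\phi$. For a $\mathbb{C}^n$-valued function $g$, $g_x$ and $g_p$ are the $n\times n$ matrices $(g_x)_{ij}=\partial_{x_i}g_j$, $(g_p)_{ij}=\partial_{p_i}g_j$. Further $(H_{xx})_{ij}=\partial_{x_i}\partial_{x_j}H$, $(H_{xp})_{ij}=\partial_{x_i}\partial_{p_j}H$, $H_{px}=H_{xp}^\top$, $(H_{pp})_{ij}=\partial_{p_i}\partial_{p_j}H$. $\tilde M(t,X)$ is complex $n\times n$ matrix valued, and ${\rm Im}$ of a matrix is taken entrywise. *)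

theory Defs
  imports "HOL-Analysis.Analysis"
begin

text \<open>A phase-space point \<open>X = (x, p)\<close> is a pair, so \<open>fst\<close> and \<open>snd\<close> give the first and the
  last \<open>n\<close> components, with \<open>n = CARD('n)\<close>.\<close>

type_synonym 'n phase = "(real ^ 'n) \<times> (real ^ 'n)"

fun Ck :: "nat \<Rightarrow> ('a::real_normed_vector \<Rightarrow> 'b::real_normed_vector) \<Rightarrow> bool" where
  "Ck 0 f \<longleftrightarrow> continuous_on UNIV f"
| "Ck (Suc k) f \<longleftrightarrow>
     f differentiable_on UNIV \<and> (\<forall>v. Ck k (\<lambda>x. frechet_derivative f (at x) v))"

definition smooth :: "('a::real_normed_vector \<Rightarrow> 'b::real_normed_vector) \<Rightarrow> bool" where
  "smooth f \<longleftrightarrow> (\<forall>k. Ck k f)"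

definition C1_on :: "'a::real_normed_vector set \<Rightarrow> ('a \<Rightarrow> 'b::real_normed_vector) \<Rightarrow> bool" where
  "C1_on S f \<longleftrightarrow>
     (\<exists>f'. (\<forall>z\<in>S. (f has_derivative blinfun_apply (f' z)) (at z within S)) \<and> continuous_on S f')"

definition dx :: "'n::finite \<Rightarrow> ('n phase \<Rightarrow> 'b::real_normed_vector) \<Rightarrow> 'n phase \<Rightarrow> 'b" where
  "dx i f X = vector_derivative (\<lambda>s. f (fst X + s *\<^sub>R axis i 1, snd X)) (at 0)"

definition dp :: "'n::finite \<Rightarrow> ('n phase \<Rightarrow> 'b::real_normed_vector) \<Rightarrow> 'n phase \<Rightarrow> 'b" where
  "dp i f X = vector_derivative (\<lambda>s. f (fst X, snd X + s *\<^sub>R axis i 1)) (at 0)"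

text \<open>For vector- and matrix-valued \<open>u\<close> the derivatives below are the entrywise ones. Time runs
  over \<open>[0, \<infinity>)\<close>, so that the time derivative is one-sided at \<open>t = 0\<close> and values of \<open>u\<close> at
  negative times play no role.\<close>

definition liouville ::
  "('n::finite phase \<Rightarrow> real) \<Rightarrow> (real \<Rightarrow> 'n phase \<Rightarrow> 'b::real_normed_vector) \<Rightarrow> real \<Rightarrow> 'n phase \<Rightarrow> 'b"
where
  "liouville H u t X =
     vector_derivative (\<lambda>s. u s X) (at t within {0..})
     + (\<Sum>i\<in>UNIV. dp i H X *\<^sub>R dx i (u t) X)
     - (\<Sum>i\<in>UNIV. dx i H X *\<^sub>R dp i (u t) X)"

text \<open>Solutions are global classical solutions: continuously differentiable on
  \<open>[0, \<infinity>) \<times> \<real>\<^sup>2\<^sup>n\<close>.\<close>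

definition C1_global :: "(real \<Rightarrow> 'n::finite phase \<Rightarrow> 'b::real_normed_vector) \<Rightarrow> bool" where
  "C1_global u \<longleftrightarrow> C1_on ({0..} \<times> UNIV) (\<lambda>(t, X). u t X)"

definition solves_liouville ::
  "('n::finite phase \<Rightarrow> real) \<Rightarrow> (real \<Rightarrow> 'n phase \<Rightarrow> 'b::real_normed_vector) \<Rightarrow> bool" where
  "solves_liouville H u \<longleftrightarrow> C1_global u \<and> (\<forall>t\<ge>0. \<forall>X. liouville H u t X = 0)"

definition Hxx :: "('n::finite phase \<Rightarrow> real) \<Rightarrow> 'n phase \<Rightarrow> complex ^ 'n ^ 'n" where
  "Hxx H X = (\<chi> i j. of_real (dx i (dx j H) X))"

definition Hxp :: "('n::finite phase \<Rightarrow> real) \<Rightarrow> 'n phase \<Rightarrow> complex ^ 'n ^ 'n" where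
  "Hxp H X = (\<chi> i j. of_real (dx i (dp j H) X))"

definition Hpx :: "('n::finite phase \<Rightarrow> real) \<Rightarrow> 'n phase \<Rightarrow> complex ^ 'n ^ 'n" where
  "Hpx H X = transpose (Hxp H X)"

definition Hpp :: "('n::finite phase \<Rightarrow> real) \<Rightarrow> 'n phase \<Rightarrow> complex ^ 'n ^ 'n" where
  "Hpp H X = (\<chi> i j. of_real (dp i (dp j H) X))"

definition solves_riccati ::
  "('n::finite phase \<Rightarrow> real) \<Rightarrow> ('n phase \<Rightarrow> complex ^ 'n ^ 'n)
     \<Rightarrow> (real \<Rightarrow> 'n phase \<Rightarrow> complex ^ 'n ^ 'n) \<Rightarrow> bool" where
  "solves_riccati H M_in M \<longleftrightarrow>
     C1_global M \<and>
     (\<forall>t\<ge>0. \<forall>X. liouville H M t X + Hxx H X + Hxp H X ** M t X + M t X ** Hpx H X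
                   + M t X ** Hpp H X ** M t X = 0) \<and>
     (\<forall>X. M 0 X = M_in X)"

definition grad_x :: "('n::finite phase \<Rightarrow> complex ^ 'n) \<Rightarrow> 'n phase \<Rightarrow> complex ^ 'n ^ 'n" where
  "grad_x g X = (\<chi> i j. dx i (\<lambda>Y. g Y $ j) X)"

definition grad_p :: "('n::finite phase \<Rightarrow> complex ^ 'n) \<Rightarrow> 'n phase \<Rightarrow> complex ^ 'n ^ 'n" where
  "grad_p g X = (\<chi> i j. dp i (\<lambda>Y. g Y $ j) X)"

definition comb ::
  "complex \<Rightarrow> complex \<Rightarrow> (real \<Rightarrow> 'n::finite phase \<Rightarrow> 'n phase) \<Rightarrow> real \<Rightarrow> 'n phase \<Rightarrow> complex ^ 'n"
where
  "comb k1 k2 \<phi> t X =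
     (\<chi> j. k1 * of_real (fst (\<phi> t X) $ j) + k2 * of_real (snd (\<phi> t X) $ j))"

definition Im_matrix :: "complex ^ 'n ^ 'm \<Rightarrow> real ^ 'n ^ 'm" where
  "Im_matrix A = (\<chi> i j. Im (A $ i $ j))"

definition positive_definite :: "real ^ 'n ^ 'n \<Rightarrow> bool" where
  "positive_definite A \<longleftrightarrow> transpose A = A \<and> (\<forall>v. v \<noteq> 0 \<longrightarrow> v \<bullet> (A *v v) > 0)"

end

theory Submission
  imports Defs
begin

text \<open>Write \<open>F t X = \<phi> t X + X0\<close>, let \<open>V\<close> be the Hamiltonian field and let \<open>G t X\<close> be the
  spatial derivative of \<open>F\<close>. The idea is that \<open>F\<close> is the flow of \<open>- V\<close>, so that \<open>G\<close> is
  symplectic; every claim about \<open>g\<^sub>x\<close> and \<open>g\<^sub>p\<close>, whose entries are combinations of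
  entries of \<open>G\<close>, is then linear algebra or differentiation along characteristics.

  The trajectories of \<open>V\<close> are not assumed to exist globally, and no existence theorem for
  ordinary differential equations is used: the given solution itself provides the flow. A maximum
  principle on cones gives local uniqueness for \<open>C\<^sup>1\<close> solutions of the transport equation
  (\<open>transport_unique_local\<close>). Applied to \<open>F (s + t) X - F s (F t X)\<close> it yields the
  semigroup property (\<open>semigroup\<close>), whence \<open>\<partial>\<^sub>t F = - V(F)\<close> (\<open>F_time\<close>).
  Differentiating the integrated equation gives \<open>\<partial>\<^sub>t G = - V'(F) G\<close> (\<open>G_time\<close>), and the symmetry
  of the second derivatives of \<open>H\<close> makes \<open>G\<close> symplectic (\<open>symplectic\<close>).

  The Riccati equation needs \<open>G\<close> to be \<open>C\<^sup>1\<close>, although \<open>\<phi>\<close> is only assumed to be \<open>C\<^sup>1\<close>.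
  This follows from variation of constants: the symplectic pairing of \<open>G t X u\<close> with
  \<open>G t Y w\<close> differs from that of \<open>u\<close> with \<open>w\<close> by the integral of an expression that contains
  the factor \<open>V'(F s X) - V'(F s Y)\<close>, and this factor is differentiable in \<open>Y\<close> and vanishes at
  \<open>Y = X\<close> (\<open>form_integral\<close>, \<open>G_has_space_deriv\<close>, \<open>G_C1\<close>). Differentiating the cocycle
  identity \<open>G t (F s X) (G s X w) = G (t + s) X w\<close> at \<open>s = 0\<close> then shows that the Liouville operator
  maps \<open>G w\<close> to \<open>- G (V' w)\<close> (\<open>G_transport\<close>).

  With \<open>P = g\<^sub>p\<close> and \<open>Q = g\<^sub>x\<close>, symplecticity of the transpose of \<open>G\<close> gives two
  identities: \<open>P\<^sup>T Q\<close> is symmetric (\<open>PQ_symmetric\<close>), and \<open>P\<^sup>* Q - Q\<^sup>* P\<close>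
  is \<open>2 i Im (k1 cnj k2)\<close> times the identity (\<open>PQ_hermitian\<close>). The second makes \<open>P\<close>
  invertible and gives the sign of the imaginary part of \<open>N = - Q P\<^sup>-\<^sup>1\<close>; the first makes \<open>N\<close>
  symmetric. Differentiating \<open>N P = - Q\<close> along the Liouville direction gives the Riccati equation
  (\<open>N_riccati\<close>). Two solutions with the same initial value agree because their difference
  satisfies a linear differential inequality along each characteristic \<open>s \<mapsto> F (T - s) X\<close>
  (\<open>riccati_unique\<close>).\<close>

section \<open>Continuously differentiable functions and derivatives along rays\<close>

text \<open>On a Euclidean domain, continuity of the derivative may be tested one direction at a time.\<close>

lemma C1_onI:
  fixes f :: "'a::euclidean_space \<Rightarrow> 'b::real_normed_vector"
  assumes D: "\<And>z. z \<in> S \<Longrightarrow> (f has_derivative f' z) (at z within S)"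
    and cont: "\<And>v. continuous_on S (\<lambda>z. f' z v)"
  shows "C1_on S f"
proof -
  have app: "blinfun_apply (Blinfun (f' z)) = f' z" if "z \<in> S" for z
    using has_derivative_bounded_linear[OF D[OF that]] by (rule bounded_linear_Blinfun_apply)
  have "continuous_on S (\<lambda>z. Blinfun (f' z))"
    by (rule continuous_on_blinfun_componentwise)
      (use cont app in \<open>simp cong: continuous_on_cong\<close>)
  then show ?thesis
    unfolding C1_on_def using D app by (intro exI[of _ "\<lambda>z. Blinfun (f' z)"]) simp
qed

lemma C1_onE:
  assumes "C1_on S f"
  obtains f' where "\<And>z. z \<in> S \<Longrightarrow> (f has_derivative f' z) (at z within S)"
    and "\<And>v. continuous_on S (\<lambda>z. f' z v)"
proof -
  obtain f' where f': "\<forall>z\<in>S. (f has_derivative blinfun_apply (f' z)) (at z within S)" "continuous_on S f'"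
    using assms unfolding C1_on_def by blast
  show ?thesis
    by (rule that[of "\<lambda>z. blinfun_apply (f' z)"])
      (use f' in \<open>auto intro!: continuous_intros\<close>)
qed

lemma C1_on_imp_continuous_on:
  assumes "C1_on S f" shows "continuous_on S f"
proof -
  obtain f' where f': "\<And>z. z \<in> S \<Longrightarrow> (f has_derivative f' z) (at z within S)"
    using assms by (rule C1_onE) blast
  then show ?thesis
    by (auto simp: continuous_on_eq_continuous_within intro: has_derivative_continuous)
qed

lemma C1_on_cong:
  assumes "C1_on S f" "\<And>z. z \<in> S \<Longrightarrow> g z = f z"
  shows "C1_on S g"
proof -
  obtain f' where f': "\<forall>z\<in>S. (f has_derivative blinfun_apply (f' z)) (at z within S)" "continuous_on S f'"
    using assms(1) unfolding C1_on_def by blast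
  have "(g has_derivative blinfun_apply (f' z)) (at z within S)" if "z \<in> S" for z
    by (rule has_derivative_transform[OF that assms(2)]) (use f' that in auto)
  then show ?thesis unfolding C1_on_def using f' by blast
qed

lemma C1_on_const: "C1_on S (\<lambda>z. c)" for S :: "'a::euclidean_space set"
  by (rule C1_onI[where f' = "\<lambda>_ _. 0"]) auto

lemma C1_on_bounded_linear:
  fixes f :: "'a::euclidean_space \<Rightarrow> 'b::real_normed_vector"
  assumes "bounded_linear h" "C1_on S f"
  shows "C1_on S (\<lambda>z. h (f z))"
proof -
  obtain f' where f': "\<And>z. z \<in> S \<Longrightarrow> (f has_derivative f' z) (at z within S)"
    "\<And>v. continuous_on S (\<lambda>z. f' z v)" using assms(2) by (rule C1_onE) blast
  show ?thesis
    by (rule C1_onI[where f' = "\<lambda>z v. h (f' z v)"])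
      (use f' in \<open>auto intro: bounded_linear.has_derivative[OF assms(1)]
        bounded_linear.continuous_on[OF assms(1)]\<close>)
qed

lemma C1_on_add:
  fixes f :: "'a::euclidean_space \<Rightarrow> 'b::real_normed_vector"
  assumes "C1_on S f" "C1_on S g"
  shows "C1_on S (\<lambda>z. f z + g z)"
proof -
  obtain f' where f': "\<And>z. z \<in> S \<Longrightarrow> (f has_derivative f' z) (at z within S)"
    "\<And>v. continuous_on S (\<lambda>z. f' z v)" using assms(1) by (rule C1_onE) blast
  obtain g' where g': "\<And>z. z \<in> S \<Longrightarrow> (g has_derivative g' z) (at z within S)"
    "\<And>v. continuous_on S (\<lambda>z. g' z v)" using assms(2) by (rule C1_onE) blast
  show ?thesis
    by (rule C1_onI[where f' = "\<lambda>z v. f' z v + g' z v"])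
      (use f' g' in \<open>auto intro!: derivative_eq_intros continuous_intros\<close>)
qed

lemma C1_on_bilinear:
  fixes f :: "'a::euclidean_space \<Rightarrow> 'b::real_normed_vector"
  assumes "bounded_bilinear pr" "C1_on S f" "C1_on S g"
  shows "C1_on S (\<lambda>z. pr (f z) (g z))"
proof -
  obtain f' where f': "\<And>z. z \<in> S \<Longrightarrow> (f has_derivative f' z) (at z within S)"
    "\<And>v. continuous_on S (\<lambda>z. f' z v)" using assms(2) by (rule C1_onE) blast
  obtain g' where g': "\<And>z. z \<in> S \<Longrightarrow> (g has_derivative g' z) (at z within S)"
    "\<And>v. continuous_on S (\<lambda>z. g' z v)" using assms(3) by (rule C1_onE) blast
  show ?thesis
    by (rule C1_onI[where f' = "\<lambda>z v. pr (f z) (g' z v) + pr (f' z v) (g z)"])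
      (use f' g' assms in \<open>auto intro!: bounded_bilinear.FDERIV[OF assms(1)] continuous_intros
        bounded_bilinear.continuous_on[OF assms(1)] intro: C1_on_imp_continuous_on\<close>)
qed

lemma C1_on_sum:
  fixes f :: "'i \<Rightarrow> 'a::euclidean_space \<Rightarrow> 'b::real_normed_vector"
  assumes "\<And>i. i \<in> I \<Longrightarrow> C1_on S (f i)"
  shows "C1_on S (\<lambda>z. \<Sum>i\<in>I. f i z)"
  using assms by (induction I rule: infinite_finite_induct) (auto intro: C1_on_add C1_on_const)

lemma C1_on_prod:
  fixes f :: "'i \<Rightarrow> 'a::euclidean_space \<Rightarrow> 'b::real_normed_field"
  assumes "\<And>i. i \<in> I \<Longrightarrow> C1_on S (f i)"
  shows "C1_on S (\<lambda>z. \<Prod>i\<in>I. f i z)"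
  using assms by (induction I rule: infinite_finite_induct)
    (auto intro: C1_on_bilinear[OF bounded_bilinear_mult] C1_on_const)

lemma C1_on_inverse:
  fixes f :: "'a::euclidean_space \<Rightarrow> 'b::real_normed_field"
  assumes "C1_on S f" "\<And>z. z \<in> S \<Longrightarrow> f z \<noteq> 0"
  shows "C1_on S (\<lambda>z. inverse (f z))"
proof -
  obtain f' where f': "\<And>z. z \<in> S \<Longrightarrow> (f has_derivative f' z) (at z within S)"
    "\<And>v. continuous_on S (\<lambda>z. f' z v)" using assms(1) by (rule C1_onE) blast
  show ?thesis
    by (rule C1_onI[where f' = "\<lambda>z v. - (inverse (f z) * f' z v * inverse (f z))"])
      (use f' assms in \<open>auto intro!: has_derivative_inverse continuous_intros
        intro: C1_on_imp_continuous_on\<close>)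
qed

lemma C1_on_vec:
  fixes A :: "'a::euclidean_space \<Rightarrow> 'b::euclidean_space ^ 'n"
  assumes "\<And>i. C1_on S (\<lambda>z. A z $ i)"
  shows "C1_on S A"
proof -
  have "\<exists>f'. \<forall>i. (\<forall>z\<in>S. ((\<lambda>z. A z $ i) has_derivative f' i z) (at z within S)) \<and>
      (\<forall>v. continuous_on S (\<lambda>z. f' i z v))"
  proof (rule choice, rule allI)
    fix i
    obtain f' where "\<And>z. z \<in> S \<Longrightarrow> ((\<lambda>z. A z $ i) has_derivative f' z) (at z within S)"
      "\<And>v. continuous_on S (\<lambda>z. f' z v)" using assms[of i] by (rule C1_onE) blast
    then show "\<exists>f'. (\<forall>z\<in>S. ((\<lambda>z. A z $ i) has_derivative f' z) (at z within S)) \<and>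
      (\<forall>v. continuous_on S (\<lambda>z. f' z v))" by blast
  qed
  then obtain f' where
    f': "\<And>i z. z \<in> S \<Longrightarrow> ((\<lambda>z. A z $ i) has_derivative f' i z) (at z within S)"
    "\<And>i v. continuous_on S (\<lambda>z. f' i z v)" by blast
  show ?thesis
  proof (rule C1_onI[where f' = "\<lambda>z v. \<chi> i. f' i z v"])
    fix z assume z: "z \<in> S"
    show "(A has_derivative (\<lambda>v. \<chi> i. f' i z v)) (at z within S)"
      by (subst has_derivative_componentwise_within)
        (use f'(1)[OF z] in \<open>auto simp: Basis_vec_def inner_axis intro!: has_derivative_inner_left\<close>)
  qed (use f'(2) in \<open>auto intro!: continuous_on_vec_lambda\<close>)
qed

lemma C1_on_det:
  fixes A :: "'a::euclidean_space \<Rightarrow> complex ^ 'n ^ 'n"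
  assumes "\<And>i j. C1_on S (\<lambda>z. A z $ i $ j)"
  shows "C1_on S (\<lambda>z. det (A z))"
  unfolding det_def
  by (intro C1_on_sum C1_on_bilinear[OF bounded_bilinear_mult] C1_on_prod C1_on_const assms)

lemma matrix_inv_inverse:
  assumes "invertible A"
  shows "A ** matrix_inv A = mat 1" "matrix_inv A ** A = mat 1"
proof -
  have "\<exists>B. A ** B = mat 1 \<and> B ** A = mat 1" using assms by (simp add: invertible_def)
  from someI_ex[OF this] show "A ** matrix_inv A = mat 1" "matrix_inv A ** A = mat 1"
    by (simp_all add: matrix_inv_def)
qed

text \<open>Cramer's rule exhibits the entries of the inverse as rational functions of the entries of the
  matrix; this is how inversion is seen to preserve continuous differentiability.\<close>

lemma matrix_inv_cramer:
  fixes A :: "'a::field ^ 'n ^ 'n"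
  assumes "invertible A"
  shows "matrix_inv A $ k $ l = det (\<chi> i j. if j = k then (if i = l then 1 else 0) else A $ i $ j) / det A"
proof -
  have AB: "A ** matrix_inv A = mat 1" using assms by (rule matrix_inv_inverse)
  have "A *v column l (matrix_inv A) = axis l 1"
  proof -
    have "A *v column l (matrix_inv A) = column l (A ** matrix_inv A)"
      by (simp add: vec_eq_iff column_def matrix_matrix_mult_def matrix_vector_mult_def)
    then show ?thesis unfolding AB by (simp add: column_def mat_def axis_def vec_eq_iff)
  qed
  moreover have "det A \<noteq> 0" using assms by (simp add: invertible_det_nz)
  ultimately have "column l (matrix_inv A) =
      (\<chi> k. det (\<chi> i j. if j = k then axis l 1 $ i else A $ i $ j) / det A)"
    by (simp add: cramer)
  moreover have "axis l 1 $ i = (if i = l then 1 else 0 :: 'a)" for i by (simp add: axis_def)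
  ultimately have "column l (matrix_inv A) $ k = det (\<chi> i j. if j = k then (if i = l then 1 else 0) else A $ i $ j) / det A"
    by (simp cong: if_cong)
  then show ?thesis by (simp add: column_def)
qed

lemma C1_on_matrix_inv:
  fixes A :: "'a::euclidean_space \<Rightarrow> complex ^ 'n ^ 'n"
  assumes "\<And>i j. C1_on S (\<lambda>z. A z $ i $ j)" and inv: "\<And>z. z \<in> S \<Longrightarrow> invertible (A z)"
  shows "C1_on S (\<lambda>z. matrix_inv (A z) $ k $ l)"
proof -
  have "C1_on S (\<lambda>z. det (\<chi> i j. if j = k then (if i = l then 1 else 0) else A z $ i $ j)
      * inverse (det (A z)))"
  proof (intro C1_on_bilinear[OF bounded_bilinear_mult] C1_on_det C1_on_inverse assms)
    show "C1_on S (\<lambda>z. (\<chi> i j. if j = k then (if i = l then 1 else 0) else A z $ i $ j) $ i $ j)"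
      for i j by (cases "j = k") (simp_all add: C1_on_const assms)
    show "det (A z) \<noteq> 0" if "z \<in> S" for z using inv[OF that] by (simp add: invertible_det_nz)
  qed
  then show ?thesis
    by (rule C1_on_cong) (simp add: matrix_inv_cramer inv divide_inverse)
qed

lemma at_within_Ici_nontrivial: "at t within {0..} \<noteq> bot" if "0 \<le> t" for t :: real
proof -
  have "at t within {t..} \<le> at t within {0..}" using that by (intro at_le) auto
  then show ?thesis
    using trivial_limit_at_right_real[of t] by (auto simp: at_within_Ici_at_right bot_unique)
qed

text \<open>The derivative of \<open>f\<close> at a space-time point, read along a ray that does not point backwards in
  time. Identities between such derivatives determine the derivative also at the boundary
  \<open>t = 0\<close>.\<close>

lemma has_vector_derivative_ray:
  fixes f :: "real \<times> 'a::real_normed_vector \<Rightarrow> 'b::real_normed_vector"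
  assumes E: "(f has_derivative E) (at (t, x) within {0..} \<times> UNIV)" and "0 \<le> t" "0 \<le> k"
  shows "((\<lambda>s. f (t + s * k, x + s *\<^sub>R v)) has_vector_derivative E (k, v)) (at 0 within {0..})"
proof -
  have "((\<lambda>s. f (t + s * k, x + s *\<^sub>R v)) has_derivative (\<lambda>h. E (h * k, h *\<^sub>R v))) (at 0 within {0..})"
  proof (rule has_derivative_in_compose[where f = "\<lambda>s. (t + s * k, x + s *\<^sub>R v)" and g' = E])
    show "((\<lambda>s. (t + s * k, x + s *\<^sub>R v)) has_derivative (\<lambda>h. (h * k, h *\<^sub>R v))) (at 0 within {0..})"
      by (auto intro!: derivative_eq_intros)
    show "(f has_derivative E) (at (t + 0 * k, x + 0 *\<^sub>R v) within (\<lambda>s. (t + s * k, x + s *\<^sub>R v)) ` {0..})"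
      by (rule has_derivative_subset[where s = "{0..} \<times> UNIV"]) (use assms in auto)
  qed
  moreover have "(\<lambda>h. E (h * k, h *\<^sub>R v)) = (\<lambda>h. h *\<^sub>R E (k, v))"
    using linear_scale[OF has_derivative_linear[OF E], of _ "(k, v)"] by auto
  ultimately show ?thesis by (simp only: has_vector_derivative_def)
qed

text \<open>A form of Gronwall's inequality: \<open>norm (E s)\<^sup>2 * exp (- 2 * C * s)\<close> is nonincreasing.\<close>

lemma gronwall_zero:
  fixes E :: "real \<Rightarrow> 'a::real_inner"
  assumes E: "\<And>s. s \<in> {0..T} \<Longrightarrow> (E has_vector_derivative E' s) (at s within {0..T})"
    and bound: "\<And>s. s \<in> {0..T} \<Longrightarrow> norm (E' s) \<le> C * norm (E s)"
    and init: "E 0 = 0" and T: "0 \<le> T"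
  shows "E T = 0"
proof -
  let ?f = "\<lambda>s. (E s \<bullet> E s) * exp (- 2 * C * s)"
  have D: "(?f has_real_derivative (2 * (E s \<bullet> E' s) - 2 * C * (E s \<bullet> E s)) * exp (- 2 * C * s))
      (at s within {0..T})" if "s \<in> {0..T}" for s
  proof -
    have "((\<lambda>s. E s \<bullet> E s) has_vector_derivative E s \<bullet> E' s + E' s \<bullet> E s) (at s within {0..T})"
      by (intro bounded_bilinear.has_vector_derivative[OF bounded_bilinear_inner] E that)
    then have "((\<lambda>s. E s \<bullet> E s) has_real_derivative 2 * (E s \<bullet> E' s)) (at s within {0..T})"
      by (simp add: has_real_derivative_iff_has_vector_derivative inner_commute)
    then show ?thesis by (auto intro!: derivative_eq_intros simp: algebra_simps)
  qed
  have "?f T \<le> ?f 0"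
  proof (rule DERIV_nonpos_imp_decreasing_open[OF T])
    show "continuous_on {0..T} ?f"
      unfolding continuous_on_eq_continuous_within using DERIV_continuous[OF D] by blast
    fix s assume s: "0 < s" "s < T"
    have "E s \<bullet> E' s \<le> norm (E s) * norm (E' s)" by (rule norm_cauchy_schwarz)
    also have "\<dots> \<le> norm (E s) * (C * norm (E s))" using bound s by (intro mult_left_mono) auto
    also have "\<dots> = C * (E s \<bullet> E s)" by (simp add: dot_square_norm power2_eq_square)
    finally have "2 * (E s \<bullet> E' s) - 2 * C * (E s \<bullet> E s) \<le> 0"
      by simp
    moreover have "at s within {0..T} = at s" using s by (intro at_within_interior) auto
    ultimately show "\<exists>y. (?f has_real_derivative y) (at s) \<and> y \<le> 0"
      using D[of s] s by (intro exI conjI) (auto intro: mult_nonpos_nonneg)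
  qed
  then have "(E T \<bullet> E T) * exp (- 2 * C * T) \<le> 0" using init by simp
  then have "E T \<bullet> E T \<le> 0" by (simp add: mult_le_0_iff not_le[symmetric])
  then show ?thesis using inner_ge_zero[of "E T"] inner_eq_zero_iff[of "E T"] by linarith
qed

section \<open>Smooth functions and the symmetry of second derivatives\<close>

lemma smooth_has_derivative:
  assumes "smooth f"
  shows "(f has_derivative frechet_derivative f (at x)) (at x)"
proof -
  have "Ck (Suc 0) f" using assms by (simp add: smooth_def del: Ck.simps)
  then show ?thesis
    by (simp add: differentiable_on_def frechet_derivative_works[symmetric])
qed

lemma smooth_frechet_derivative:
  assumes "smooth f"
  shows "smooth (\<lambda>x. frechet_derivative f (at x) v)"
proof -
  have "Ck (Suc k) f" for k using assms by (simp add: smooth_def del: Ck.simps)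
  then show ?thesis by (simp add: smooth_def)
qed

lemma smooth_continuous: "smooth f \<Longrightarrow> continuous_on UNIV f"
  unfolding smooth_def by (metis Ck.simps(1))

text \<open>Two applications of the mean value theorem to the second difference of \<open>f\<close> over a
  parallelogram; exchanging \<open>u\<close> and \<open>v\<close> leaves the left-hand side unchanged, which yields
  the symmetry of second derivatives.\<close>

lemma second_difference_mean_value:
  fixes f :: "'a::real_normed_vector \<Rightarrow> real"
  assumes f: "\<And>x. (f has_derivative f' x) (at x)"
    and fu: "\<And>x. ((\<lambda>x. f' x u) has_derivative f'' x) (at x)" and h: "0 < h"
  shows "\<exists>a\<in>{0..h}. \<exists>b\<in>{0..h}. f (x + h *\<^sub>R u + h *\<^sub>R v) - f (x + h *\<^sub>R u) - f (x + h *\<^sub>R v) + f x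
     = h\<^sup>2 * f'' (x + a *\<^sub>R u + b *\<^sub>R v) v"
proof -
  have df: "((\<lambda>s. f (y + s *\<^sub>R w)) has_derivative (\<lambda>r. r * f' (y + s *\<^sub>R w) w)) (at s)" for y w s
  proof -
    have "linear (f' (y + s *\<^sub>R w))" using f has_derivative_linear by blast
    moreover have "((\<lambda>s. f (y + s *\<^sub>R w)) has_derivative (\<lambda>r. f' (y + s *\<^sub>R w) (r *\<^sub>R w))) (at s)"
      by (rule has_derivative_compose[OF _ f, of "\<lambda>s. y + s *\<^sub>R w"])
        (auto intro!: derivative_eq_intros)
    ultimately show ?thesis by (simp add: linear_scale)
  qed
  have dfu: "((\<lambda>s. f' (y + s *\<^sub>R w) u) has_derivative (\<lambda>r. r * f'' (y + s *\<^sub>R w) w)) (at s)" for y w s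
  proof -
    have "linear (f'' (y + s *\<^sub>R w))" using fu has_derivative_linear by blast
    moreover have "((\<lambda>s. f' (y + s *\<^sub>R w) u) has_derivative (\<lambda>r. f'' (y + s *\<^sub>R w) (r *\<^sub>R w))) (at s)"
      by (rule has_derivative_compose[OF _ fu, of "\<lambda>s. y + s *\<^sub>R w"])
        (auto intro!: derivative_eq_intros)
    ultimately show ?thesis by (simp add: linear_scale)
  qed
  have "\<exists>a\<in>{0<..<h}. (f (x + h *\<^sub>R v + h *\<^sub>R u) - f (x + h *\<^sub>R u)) - (f (x + h *\<^sub>R v + 0 *\<^sub>R u) - f (x + 0 *\<^sub>R u))
      = (h - 0) * f' (x + h *\<^sub>R v + a *\<^sub>R u) u - (h - 0) * f' (x + a *\<^sub>R u) u"
    by (rule mvt_simple[OF h, where f = "\<lambda>s. f (x + h *\<^sub>R v + s *\<^sub>R u) - f (x + s *\<^sub>R u)"])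
      (auto intro!: has_derivative_diff has_derivative_at_withinI[OF df])
  then obtain a where a: "a \<in> {0<..<h}" and eq1:
    "f (x + h *\<^sub>R u + h *\<^sub>R v) - f (x + h *\<^sub>R u) - f (x + h *\<^sub>R v) + f x
      = h * (f' (x + a *\<^sub>R u + h *\<^sub>R v) u - f' (x + a *\<^sub>R u) u)"
    by (auto simp: algebra_simps)
  have "\<exists>b\<in>{0<..<h}. f' (x + a *\<^sub>R u + h *\<^sub>R v) u - f' (x + a *\<^sub>R u + 0 *\<^sub>R v) u
      = (h - 0) * f'' (x + a *\<^sub>R u + b *\<^sub>R v) v"
    by (rule mvt_simple[OF h, where f = "\<lambda>s. f' (x + a *\<^sub>R u + s *\<^sub>R v) u"])
      (auto intro!: has_derivative_at_withinI[OF dfu])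
  then show ?thesis using a eq1 by (force simp: power2_eq_square)
qed

lemma second_derivative_symmetric:
  fixes f :: "'a::real_normed_vector \<Rightarrow> real"
  assumes f: "\<And>x. (f has_derivative f' x) (at x)"
    and fu: "\<And>x. ((\<lambda>x. f' x u) has_derivative fu' x) (at x)"
    and fv: "\<And>x. ((\<lambda>x. f' x v) has_derivative fv' x) (at x)"
    and cu: "isCont (\<lambda>x. fu' x v) x" and cv: "isCont (\<lambda>x. fv' x u) x"
  shows "fu' x v = fv' x u"
proof -
  define h :: "nat \<Rightarrow> real" where "h n = 1 / Suc n" for n
  have h0: "h n > 0" for n by (simp add: h_def)
  have hl: "h \<longlonglongrightarrow> 0" unfolding h_def by (rule LIMSEQ_inverse_real_of_nat[unfolded inverse_eq_divide])
  have "\<exists>a b c d. a \<in> {0..h n} \<and> b \<in> {0..h n} \<and> c \<in> {0..h n} \<and> d \<in> {0..h n} \<and>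
     fu' (x + a *\<^sub>R u + b *\<^sub>R v) v = fv' (x + c *\<^sub>R v + d *\<^sub>R u) u" for n
  proof -
    obtain a b where ab: "a \<in> {0..h n}" "b \<in> {0..h n}"
      "f (x + h n *\<^sub>R u + h n *\<^sub>R v) - f (x + h n *\<^sub>R u) - f (x + h n *\<^sub>R v) + f x
        = (h n)\<^sup>2 * fu' (x + a *\<^sub>R u + b *\<^sub>R v) v"
      using second_difference_mean_value[OF f fu h0] by blast
    obtain c d where cd: "c \<in> {0..h n}" "d \<in> {0..h n}"
      "f (x + h n *\<^sub>R v + h n *\<^sub>R u) - f (x + h n *\<^sub>R v) - f (x + h n *\<^sub>R u) + f x
        = (h n)\<^sup>2 * fv' (x + c *\<^sub>R v + d *\<^sub>R u) u"
      using second_difference_mean_value[OF f fv h0] by blast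
    have "(h n)\<^sup>2 * fu' (x + a *\<^sub>R u + b *\<^sub>R v) v = (h n)\<^sup>2 * fv' (x + c *\<^sub>R v + d *\<^sub>R u) u"
    proof -
      have "x + h n *\<^sub>R v + h n *\<^sub>R u = x + h n *\<^sub>R u + h n *\<^sub>R v" by simp
      with ab(3) cd(3) show ?thesis
        by (simp only: cancel_ab_semigroup_add_class.diff_right_commute[of "f (x + h n *\<^sub>R u + h n *\<^sub>R v)" "f (x + h n *\<^sub>R v)"])
    qed
    then show ?thesis using h0[of n] ab cd by auto
  qed
  then obtain a b c d where abcd: "\<And>n. a n \<in> {0..h n}" "\<And>n. b n \<in> {0..h n}"
    "\<And>n. c n \<in> {0..h n}" "\<And>n. d n \<in> {0..h n}"
    and eq: "\<And>n. fu' (x + a n *\<^sub>R u + b n *\<^sub>R v) v = fv' (x + c n *\<^sub>R v + d n *\<^sub>R u) u"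
    by metis
  have lim: "e \<longlonglongrightarrow> 0" if "\<And>n. e n \<in> {0..h n}" for e :: "nat \<Rightarrow> real"
    by (rule tendsto_sandwich[OF _ _ tendsto_const hl]) (use that in auto)
  have "(\<lambda>n. x + a n *\<^sub>R u + b n *\<^sub>R v) \<longlonglongrightarrow> x + 0 *\<^sub>R u + 0 *\<^sub>R v"
    by (intro tendsto_intros lim abcd)
  then have 1: "(\<lambda>n. fu' (x + a n *\<^sub>R u + b n *\<^sub>R v) v) \<longlonglongrightarrow> fu' x v"
    using isCont_tendsto_compose[OF cu] by simp
  have "(\<lambda>n. x + c n *\<^sub>R v + d n *\<^sub>R u) \<longlonglongrightarrow> x + 0 *\<^sub>R v + 0 *\<^sub>R u"
    by (intro tendsto_intros lim abcd)
  then have 2: "(\<lambda>n. fu' (x + a n *\<^sub>R u + b n *\<^sub>R v) v) \<longlonglongrightarrow> fv' x u"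
    using isCont_tendsto_compose[OF cv] eq by simp
  show ?thesis using 1 2 by (rule LIMSEQ_unique)
qed

lemma smooth_second_derivative_symmetric:
  fixes f :: "'a::real_normed_vector \<Rightarrow> real"
  assumes "smooth f"
  shows "frechet_derivative (\<lambda>y. frechet_derivative f (at y) u) (at x) v =
    frechet_derivative (\<lambda>y. frechet_derivative f (at y) v) (at x) u"
proof (rule second_derivative_symmetric[where f = f and f' = "\<lambda>y. frechet_derivative f (at y)"])
  show "isCont (\<lambda>x. frechet_derivative (\<lambda>y. frechet_derivative f (at y) a) (at x) b) x" for a b
    by (metis assms smooth_frechet_derivative smooth_continuous continuous_on_eq_continuous_at
        open_UNIV UNIV_I)
  then show "isCont (\<lambda>x. frechet_derivative (\<lambda>y. frechet_derivative f (at y) v) (at x) u) x" .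
qed (intro smooth_has_derivative smooth_frechet_derivative assms)+

section \<open>Transport equations and the semigroup of a global solution\<close>

text \<open>A differentiable solution with zero initial value is nonpositive on the cone of points
  \<open>(s, y)\<close> with \<open>dist x y \<le> 1 - C * s\<close>, where \<open>C\<close> bounds the speed: the cone is left
  invariant when a point moves backwards along \<open>(1, V)\<close>, so that a solution tilted by
  a multiple of the time cannot have its maximum at a positive time.\<close>

lemma transport_max_principle:
  fixes u :: "real \<Rightarrow> 'a::euclidean_space \<Rightarrow> real" and V :: "'a \<Rightarrow> 'a"
  assumes D: "\<And>t x. 0 \<le> t \<Longrightarrow>
      ((\<lambda>(t, x). u t x) has_derivative u' (t, x)) (at (t, x) within {0..} \<times> UNIV)"
    and pde: "\<And>t x. 0 \<le> t \<Longrightarrow> u' (t, x) (1, V x) = 0"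
    and init: "\<And>x. u 0 x = 0"
    and C: "0 < C" "\<And>y. y \<in> cball x 1 \<Longrightarrow> norm (V y) \<le> C"
    and t: "0 \<le> t" "t * C \<le> 1"
  shows "u t x \<le> 0"
proof (rule field_le_epsilon)
  fix e :: real assume e: "0 < e"
  define K where "K = {z. 0 \<le> fst z \<and> dist x (snd z) \<le> 1 - C * fst z}"
  \<comment> \<open>The derivative of \<open>v\<close> along \<open>(1, V)\<close> is \<open>- e * C < 0\<close>; on the cone \<open>C * fst z \<le> 1\<close>,
    so that the correction is at most \<open>e\<close>.\<close>
  define v where "v = (\<lambda>z. u (fst z) (snd z) - e * C * fst z)"
  have K_sub: "K \<subseteq> {0..1 / C} \<times> cball x 1"
  proof
    fix z assume z: "z \<in> K"
    have "0 \<le> dist x (snd z)" by simp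
    then have "C * fst z \<le> 1" using z by (auto simp: K_def simp del: zero_le_dist)
    moreover have "0 \<le> C * fst z" using z C by (auto simp: K_def)
    moreover have "dist x (snd z) \<le> 1 - C * fst z" "0 \<le> fst z" using z by (auto simp: K_def)
    moreover have "dist x (snd z) \<le> 1" using calculation by linarith
    ultimately show "z \<in> {0..1 / C} \<times> cball x 1"
      using C(1) by (auto simp: mem_Times_iff field_simps)
  qed
  have "closed K"
    unfolding K_def by (intro closed_Collect_conj closed_Collect_le continuous_intros)
  then have "compact (({0..1 / C} \<times> cball x 1) \<inter> K)"
    by (intro compact_Int_closed compact_Times compact_Icc compact_cball)
  then have "compact K" using K_sub by (simp add: Int_absorb1)
  have v: "(v has_derivative (\<lambda>h. u' z h - e * C * fst h)) (at z within {0..} \<times> UNIV)"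
    if "0 \<le> fst z" for z
  proof -
    have "((\<lambda>z. u (fst z) (snd z)) has_derivative u' z) (at z within {0..} \<times> UNIV)"
      using D[OF that, of "snd z"] by (simp add: split_def)
    then show ?thesis unfolding v_def by (auto intro!: derivative_eq_intros)
  qed
  have "continuous_on ({0..} \<times> UNIV) v"
    by (auto simp: continuous_on_eq_continuous_within intro!: has_derivative_continuous[OF v])
  then have "continuous_on K v" by (rule continuous_on_subset) (auto simp: K_def mem_Times_iff)
  have tx: "(t, x) \<in> K" using t by (simp add: K_def mult.commute)
  then obtain z where z: "z \<in> K" and max: "\<And>y. y \<in> K \<Longrightarrow> v y \<le> v z"
    using continuous_attains_sup[OF \<open>compact K\<close> _ \<open>continuous_on K v\<close>] by blast
  have z1: "fst z \<ge> 0" "snd z \<in> cball x 1" using K_sub z by (auto simp: K_def)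
  have "fst z = 0"
  proof (rule ccontr)
    assume "fst z \<noteq> 0"
    then have s: "fst z > 0" using z1 by simp
    let ?p = "\<lambda>h. (fst z - h, snd z - h *\<^sub>R V (snd z))"
    have pK: "?p h \<in> K" if "h \<in> {0..fst z}" for h
    proof -
      have "dist x (snd z - h *\<^sub>R V (snd z)) \<le> dist x (snd z) + dist (snd z) (snd z - h *\<^sub>R V (snd z))"
        by (rule dist_triangle)
      also have "\<dots> \<le> dist x (snd z) + h * C"
        using C(2)[OF z1(2)] that by (simp add: dist_norm mult_left_mono)
      also have "\<dots> \<le> 1 - C * (fst z - h)" using z by (simp add: K_def algebra_simps)
      finally show ?thesis using that by (simp add: K_def)
    qed
    have "((\<lambda>h. v (?p h)) has_derivative (\<lambda>h. u' z (- h, - (h *\<^sub>R V (snd z))) - e * C * (- h)))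
        (at 0 within {0..fst z})"
    proof (rule has_derivative_eq_rhs[OF has_derivative_in_compose2[where t = "{0..} \<times> UNIV" and g = v
          and g' = "\<lambda>z h. u' z h - e * C * fst h" and f = ?p]])
      show "(?p has_derivative (\<lambda>h. (- h, - (h *\<^sub>R V (snd z))))) (at 0 within {0..fst z})"
        by (auto intro!: derivative_eq_intros)
    qed (use v s in auto)
    moreover have "u' z (- h, - (h *\<^sub>R V (snd z))) = 0" for h
    proof -
      have "linear (u' z)" using D[OF z1(1), of "snd z"] has_derivative_linear by fastforce
      then have "u' z ((- h) *\<^sub>R (1, V (snd z))) = (- h) *\<^sub>R u' z (1, V (snd z))" by (rule linear_scale)
      then show ?thesis using pde[OF z1(1), of "snd z"] by simp
    qed
    ultimately have "((\<lambda>h. v (?p h)) has_real_derivative e * C) (at 0 within {0..fst z})"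
      by (simp add: has_field_derivative_def mult.commute mult_commute_abs)
    moreover have "0 < e * C" using e C(1) by simp
    ultimately have "\<exists>d>0. \<forall>h>0. 0 + h \<in> {0..fst z} \<longrightarrow> h < d \<longrightarrow> v (?p 0) < v (?p (0 + h))"
      by (rule has_real_derivative_pos_inc_right)
    then obtain d where d: "0 < d" "\<And>h. 0 < h \<Longrightarrow> 0 + h \<in> {0..fst z} \<Longrightarrow> h < d \<Longrightarrow> v (?p 0) < v (?p (0 + h))"
      by blast
    define h where "h = min (d / 2) (fst z)"
    have "v z < v (?p h)" using d(2)[of h] d(1) s by (auto simp: h_def)
    moreover have "v (?p h) \<le> v z" using s d(1) by (intro max pK) (auto simp: h_def)
    ultimately show False by simp
  qed
  then have "v z = 0" using init by (simp add: v_def)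
  then have "u t x \<le> e * (t * C)" using max[OF tx] by (simp add: v_def mult.commute mult.left_commute)
  also have "\<dots> \<le> e * 1" using e t(2) by (intro mult_left_mono) auto
  finally show "u t x \<le> 0 + e" by simp
qed

lemma transport_unique_local:
  fixes u :: "real \<Rightarrow> 'a::euclidean_space \<Rightarrow> 'b::euclidean_space" and V :: "'a \<Rightarrow> 'a"
  assumes D: "\<And>t x. 0 \<le> t \<Longrightarrow>
      ((\<lambda>(t, x). u t x) has_derivative u' (t, x)) (at (t, x) within {0..} \<times> UNIV)"
    and pde: "\<And>t x. 0 \<le> t \<Longrightarrow> u' (t, x) (1, V x) = 0"
    and init: "\<And>x. u 0 x = 0"
    and C: "0 < C" "\<And>y. y \<in> cball x 1 \<Longrightarrow> norm (V y) \<le> C"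
    and t: "0 \<le> t" "t * C \<le> 1"
  shows "u t x = 0"
proof -
  have le: "u t x \<bullet> b \<le> 0" for b
  proof (rule transport_max_principle[where u = "\<lambda>t x. u t x \<bullet> b" and u' = "\<lambda>z h. u' z h \<bullet> b"])
    show "((\<lambda>(t, x). u t x \<bullet> b) has_derivative (\<lambda>h. u' (t, x) h \<bullet> b)) (at (t, x) within {0..} \<times> UNIV)"
      if "0 \<le> t" for t x
      using has_derivative_inner_left[OF D[OF that, of x], of b] by (simp add: split_def)
    show "u' (t, x) (1, V x) \<bullet> b = 0" if "0 \<le> t" for t x using pde[OF that] by simp
  qed (use init C t in auto)
  then show ?thesis using inner_eq_zero_iff[of "u t x"] inner_ge_zero[of "u t x"] le[of "u t x"] by linarith
qed

text \<open>A global \<open>C\<^sup>1\<close> solution \<open>F\<close> of the transport equation of \<open>V\<close> with the identity as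
  initial value. \<open>F'\<close> is its space-time derivative, and \<open>V'\<close>, \<open>V''\<close> are the first two
  derivatives of \<open>V\<close>; no growth condition is imposed on \<open>V\<close>.\<close>

locale transport =
  fixes V :: "'a::euclidean_space \<Rightarrow> 'a"
    and V' :: "'a \<Rightarrow> 'a \<Rightarrow>\<^sub>L 'a"
    and V'' :: "'a \<Rightarrow> 'a \<Rightarrow>\<^sub>L ('a \<Rightarrow>\<^sub>L 'a)"
    and F :: "real \<Rightarrow> 'a \<Rightarrow> 'a"
    and F' :: "real \<times> 'a \<Rightarrow> (real \<times> 'a) \<Rightarrow>\<^sub>L 'a"
  assumes V_deriv: "\<And>x. (V has_derivative blinfun_apply (V' x)) (at x)"
    and V'_deriv: "\<And>x. (V' has_derivative blinfun_apply (V'' x)) (at x)"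
    and V''_cont: "continuous_on UNIV V''"
    and F_deriv: "\<And>t x. 0 \<le> t \<Longrightarrow>
      ((\<lambda>(t, x). F t x) has_derivative blinfun_apply (F' (t, x))) (at (t, x) within {0..} \<times> UNIV)"
    and F'_cont: "continuous_on ({0..} \<times> UNIV) F'"
    and pde: "\<And>t x. 0 \<le> t \<Longrightarrow> F' (t, x) (1, V x) = 0"
    and init: "\<And>x. F 0 x = x"
begin

lemma F_deriv_compose:
  fixes p :: "'c::real_normed_vector \<Rightarrow> real"
  assumes "\<And>z. z \<in> S \<Longrightarrow> 0 \<le> p z" "z \<in> S"
    and "(p has_derivative p') (at z within S)" "(q has_derivative q') (at z within S)"
  shows "((\<lambda>z. F (p z) (q z)) has_derivative (\<lambda>h. F' (p z, q z) (p' h, q' h))) (at z within S)"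
proof -
  have "((\<lambda>z. (\<lambda>(t, x). F t x) (p z, q z)) has_derivative (\<lambda>h. F' (p z, q z) (p' h, q' h))) (at z within S)"
    by (rule has_derivative_in_compose2[where t = "{0..} \<times> UNIV" and f = "\<lambda>z. (p z, q z)"
        and g' = "\<lambda>z. blinfun_apply (F' z)"])
      (use assms F_deriv in \<open>auto intro!: has_derivative_Pair\<close>)
  then show ?thesis by simp
qed

lemma continuous_on_F:
  fixes p :: "'c::topological_space \<Rightarrow> real"
  assumes "continuous_on S p" "continuous_on S q" "\<And>z. z \<in> S \<Longrightarrow> 0 \<le> p z"
  shows "continuous_on S (\<lambda>z. F (p z) (q z))"
proof -
  have "continuous_on ({0..} \<times> UNIV) (\<lambda>(t, x). F t x)"
    unfolding continuous_on_eq_continuous_within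
    using F_deriv by (auto intro!: has_derivative_continuous)
  from continuous_on_compose2[OF this, of S "\<lambda>z. (p z, q z)"]
  show ?thesis using assms by (auto intro!: continuous_intros)
qed

lemma semigroup_local:
  assumes C: "0 < C" "\<And>y. y \<in> cball x 1 \<Longrightarrow> norm (V y) \<le> C"
    and t: "0 \<le> t" "t * C \<le> 1" and s: "0 \<le> s"
  shows "F (s + t) x = F s (F t x)"
proof -
  have "F (s + t) x - F s (F t x) = 0"
  proof (rule transport_unique_local[where u = "\<lambda>t x. F (s + t) x - F s (F t x)"
        and u' = "\<lambda>z h. F' (s + fst z, snd z) h - F' (s, F (fst z) (snd z)) (0, F' z h)"])
    fix t :: real and x assume t: "0 \<le> t"
    have "((\<lambda>z. F (s + fst z) (snd z) - F s (F (fst z) (snd z))) has_derivative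
      (\<lambda>h. F' (s + fst (t, x), snd (t, x)) (fst h, snd h)
        - F' (s, F (fst (t, x)) (snd (t, x))) (0, F' (fst (t, x), snd (t, x)) (fst h, snd h))))
      (at (t, x) within {0..} \<times> UNIV)"
      by (intro has_derivative_diff F_deriv_compose) (use s t in \<open>auto intro!: derivative_eq_intros\<close>)
    then show "((\<lambda>(t, x). F (s + t) x - F s (F t x)) has_derivative
      (\<lambda>h. F' (s + fst (t, x), snd (t, x)) h - F' (s, F (fst (t, x)) (snd (t, x))) (0, F' (t, x) h)))
      (at (t, x) within {0..} \<times> UNIV)"
      by (simp add: split_def)
    have "F' (s, F t x) (0, 0) = 0"
      by (metis blinfun.zero_right zero_prod_def)
    then show "F' (s + fst (t, x), snd (t, x)) (1, V x) -
       F' (s, F (fst (t, x)) (snd (t, x))) (0, F' (t, x) (1, V x)) = 0"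
      using pde s t by simp
  qed (use assms init in auto)
  then show ?thesis by simp
qed

text \<open>The time step allowed by the local version depends on a bound of the speed near the point. Along
  the compact set of all \<open>F t x\<close> with \<open>0 \<le> t \<le> T\<close> one bound \<open>C\<close> serves, and the claim follows by
  induction on the number of steps of length \<open>1 / C\<close>.\<close>

lemma semigroup:
  assumes "0 \<le> s" "0 \<le> T"
  shows "F (s + T) x = F s (F T x)"
proof -
  have "compact ((\<lambda>t. F t x) ` {0..T})"
    by (intro compact_continuous_image continuous_on_F continuous_intros) auto
  then have "bounded ((\<lambda>t. F t x) ` {0..T})" by (rule compact_imp_bounded)
  then obtain B where B: "\<And>t. t \<in> {0..T} \<Longrightarrow> norm (F t x) \<le> B"
    unfolding bounded_iff by blast
  have "continuous_on (cball 0 (B + 1)) V"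
    using V_deriv by (intro continuous_at_imp_continuous_on ballI) (rule has_derivative_continuous)
  then have "bounded (V ` cball 0 (B + 1))"
    by (intro compact_imp_bounded compact_continuous_image) auto
  then obtain C where C: "0 < C" "\<And>y. y \<in> cball 0 (B + 1) \<Longrightarrow> norm (V y) \<le> C"
    by (auto simp: bounded_pos)
  have bound: "norm (V y) \<le> C" if "t \<in> {0..T}" "y \<in> cball (F t x) 1" for t y
  proof (rule C(2))
    have "norm y \<le> norm (F t x) + norm (y - F t x)" by (rule norm_triangle_sub)
    then show "y \<in> cball 0 (B + 1)" using B[OF that(1)] that(2) by (simp add: dist_norm norm_minus_commute)
  qed
  have local: "F (s + h) (F r x) = F s (F h (F r x))"
    if "r \<in> {0..T}" "0 \<le> h" "h * C \<le> 1" "0 \<le> s" for r h s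
    using bound[OF that(1)] that(2-) by (rule semigroup_local[OF C(1)])
  have "\<forall>t s. 0 \<le> t \<and> t \<le> T \<and> t * C \<le> real n \<and> 0 \<le> s \<longrightarrow> F (s + t) x = F s (F t x)" for n
  proof (induction n)
    case 0
    show ?case
    proof (intro allI impI)
      fix t s :: real assume t: "0 \<le> t \<and> t \<le> T \<and> t * C \<le> real 0 \<and> 0 \<le> s"
      then have "t = 0" using C(1) by (simp add: mult_le_0_iff)
      then show "F (s + t) x = F s (F t x)" by (simp add: init)
    qed
  next
    case (Suc n)
    show ?case
    proof (intro allI impI)
      fix t s :: real assume t: "0 \<le> t \<and> t \<le> T \<and> t * C \<le> real (Suc n) \<and> 0 \<le> s"
      define t' where "t' = max 0 (t - 1 / C)"
      have "(t - 1 / C) * C = t * C - 1" using C(1) by (simp add: field_simps)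
      then have "(t - 1 / C) * C \<le> n" using t by simp
      then have t': "0 \<le> t'" "t' \<le> T" "t' * C \<le> n" "0 \<le> t - t'"
      proof -
        have "0 < 1 / C" using C(1) by simp
        then have "t - 1 / C \<le> t" by linarith
        moreover have "0 \<le> t" "t \<le> T" using t by auto
        ultimately show "t' \<le> T" "0 \<le> t - t'" unfolding t'_def by linarith+
      qed (use \<open>(t - 1 / C) * C \<le> n\<close> in \<open>auto simp: t'_def max_def\<close>)
      have h: "(t - t') * C \<le> 1"
      proof -
        have "t - t' \<le> 1 / C" by (simp add: t'_def)
        then show ?thesis using C(1) by (simp add: field_simps)
      qed
      have IH: "F (r + t') x = F r (F t' x)" if "0 \<le> r" for r
        using Suc.IH t' that by blast
      have "F (s + t) x = F ((s + (t - t')) + t') x" by simp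
      also have "\<dots> = F (s + (t - t')) (F t' x)" using t t' by (intro IH) auto
      also have "\<dots> = F s (F (t - t') (F t' x))" using t t' h by (intro local) auto
      also have "F (t - t') (F t' x) = F t x" using IH[of "t - t'"] t' by simp
      finally show "F (s + t) x = F s (F t x)" .
    qed
  qed
  moreover obtain n where "T * C \<le> real n" using real_arch_simple by blast
  ultimately show ?thesis using assms by blast
qed

lemma F'_init: "F' (0, x) (0, v) = v"
proof -
  have "(F 0 has_derivative (\<lambda>h. F' (0, x) (0, h))) (at x)"
    by (rule F_deriv_compose[where q = "\<lambda>y. y" and p = "\<lambda>_. 0" and S = UNIV]) (auto intro!: derivative_eq_intros)
  moreover have "(F 0 has_derivative (\<lambda>h. h)) (at x)"
    by (rule has_derivative_transform[OF UNIV_I init has_derivative_ident])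
  ultimately have "(\<lambda>h. F' (0, x) (0, h)) = (\<lambda>h. h)" by (rule has_derivative_unique)
  then show ?thesis by (rule fun_cong)
qed

text \<open>At time \<open>0\<close> the transport equation itself gives the time derivative \<open>- V\<close>; the semigroup
  property carries this to all times.\<close>

lemma F_time:
  assumes t: "0 \<le> t"
  shows "((\<lambda>t. F t x) has_vector_derivative - V (F t x)) (at t within {0..})"
proof -
  have D: "((\<lambda>s. F (c + s) y) has_vector_derivative F' (c + s, y) (1, 0)) (at s within {0..})"
    if "0 \<le> c" "0 \<le> s" for c s y
  proof -
    have "((\<lambda>s. F (c + s) y) has_derivative (\<lambda>h. F' (c + s, y) (h, 0))) (at s within {0..})"
      by (rule F_deriv_compose) (use that in \<open>auto intro!: derivative_eq_intros\<close>)
    moreover have "(\<lambda>h. F' (c + s, y) (h, 0)) = (\<lambda>h. h *\<^sub>R F' (c + s, y) (1, 0))"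
    proof
      show "F' (c + s, y) (h, 0) = h *\<^sub>R F' (c + s, y) (1, 0)" for h
        using blinfun.scaleR_right[of "F' (c + s, y)" h "(1, 0)"] by simp
    qed
    ultimately show ?thesis by (simp only: has_vector_derivative_def)
  qed
  have "((\<lambda>s. F (t + s) x) has_vector_derivative F' (t, x) (1, 0)) (at 0 within {0..})"
    using D[OF t, of 0 x] by simp
  moreover have "((\<lambda>s. F (t + s) x) has_vector_derivative F' (0, F t x) (1, 0)) (at 0 within {0..})"
  proof (rule has_vector_derivative_transform[of _ _ _ "\<lambda>s. F (0 + s) (F t x)"])
    show "F (t + s) x = F (0 + s) (F t x)" if "s \<in> {0..}" for s
      using semigroup[of s t x] that t by (simp add: add.commute)
  qed (use D[of 0 0 "F t x"] in auto)
  ultimately have "F' (t, x) (1, 0) = F' (0, F t x) (1, 0)"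
    by (rule vector_derivative_unique_within[rotated]) (simp add: at_within_Ici_at_right)
  also have "\<dots> = F' (0, F t x) (1, V (F t x)) - F' (0, F t x) (0, V (F t x))"
    by (simp flip: blinfun.diff_right)
  also have "\<dots> = - V (F t x)" using pde F'_init by simp
  finally show ?thesis using D[of 0 t x] t by simp
qed

section \<open>The linearised flow\<close>

text \<open>The spatial derivative of the solution at time \<open>t\<close>.\<close>

definition G :: "real \<Rightarrow> 'a \<Rightarrow> 'a \<Rightarrow>\<^sub>L 'a" where
  "G t x = F' (t, x) o\<^sub>L Blinfun (Pair 0)"

lemma G_apply: "G t x v = F' (t, x) (0, v)"
proof -
  have "bounded_linear (Pair 0 :: 'a \<Rightarrow> real \<times> 'a)"
    by (intro bounded_linear_Pair bounded_linear_zero bounded_linear_ident)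
  then show ?thesis by (simp add: G_def bounded_linear_Blinfun_apply)
qed

lemma F_deriv_space:
  assumes "0 \<le> t"
  shows "(F t has_derivative blinfun_apply (G t x)) (at x)"
proof -
  have "(F t has_derivative (\<lambda>h. F' (t, x) (0, h))) (at x)"
    by (rule F_deriv_compose[where q = "\<lambda>y. y" and p = "\<lambda>_. t" and S = UNIV])
      (use assms in \<open>auto intro!: derivative_eq_intros\<close>)
  then show ?thesis by (simp add: G_apply[abs_def])
qed

lemma continuous_on_G:
  fixes p :: "'c::topological_space \<Rightarrow> real"
  assumes "continuous_on S p" "continuous_on S q" "\<And>z. z \<in> S \<Longrightarrow> 0 \<le> p z"
  shows "continuous_on S (\<lambda>z. G (p z) (q z))"
proof -
  have "continuous_on S (\<lambda>z. F' (p z, q z))"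
    by (rule continuous_on_compose2[OF F'_cont]) (use assms in \<open>auto intro!: continuous_intros\<close>)
  then show ?thesis unfolding G_def
    by (intro bounded_bilinear.continuous_on[OF bounded_bilinear_blinfun_compose] continuous_intros)
qed

lemma continuous_on_V': "continuous_on S q \<Longrightarrow> continuous_on S (\<lambda>z. V' (q z))"
  by (rule continuous_on_compose2[of UNIV V'])
    (auto intro!: continuous_at_imp_continuous_on has_derivative_continuous[OF V'_deriv])

lemma continuous_on_V'': "continuous_on S q \<Longrightarrow> continuous_on S (\<lambda>z. V'' (q z))"
  using continuous_on_compose2[OF V''_cont, of S q] by auto

lemma continuous_on_V: "continuous_on S q \<Longrightarrow> continuous_on S (\<lambda>z. V (q z))"
  by (rule continuous_on_compose2[of UNIV V])
    (auto intro!: continuous_at_imp_continuous_on has_derivative_continuous[OF V_deriv])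

lemma continuous_on_blinfun_compose:
  "continuous_on S f \<Longrightarrow> continuous_on S g \<Longrightarrow> continuous_on S (\<lambda>z. f z o\<^sub>L g z)"
  by (rule bounded_bilinear.continuous_on[OF bounded_bilinear_blinfun_compose])

lemmas flow_continuous_intros =
  continuous_on_F continuous_on_G continuous_on_V' continuous_on_V'' continuous_on_V
  continuous_on_blinfun_compose

lemma G_init: "G 0 x v = v"
  by (simp add: G_apply F'_init)

lemma G_cocycle:
  assumes "0 \<le> s" "0 \<le> t"
  shows "G (s + t) x v = G s (F t x) (G t x v)"
proof -
  have "((\<lambda>x. F s (F t x)) has_derivative (\<lambda>v. G s (F t x) (G t x v))) (at x)"
    using F_deriv_space assms by (intro has_derivative_compose[of "F t" _ _ _ "F s"])
  moreover have "(\<lambda>x. F s (F t x)) = F (s + t)" using semigroup assms by auto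
  ultimately have "(F (s + t) has_derivative (\<lambda>v. G s (F t x) (G t x v))) (at x)" by simp
  moreover have "(F (s + t) has_derivative G (s + t) x) (at x)"
    using assms by (intro F_deriv_space) simp
  ultimately have "(\<lambda>v. G s (F t x) (G t x v)) = G (s + t) x" by (rule has_derivative_unique)
  then show ?thesis by (rule fun_cong[symmetric])
qed

lemma F_integral:
  assumes "0 \<le> t"
  shows "F t x = x - integral (cbox 0 t) (\<lambda>s. V (F s x))"
proof -
  have "((\<lambda>s. - V (F s x)) has_integral (F t x - F 0 x)) {0..t}"
    using assms by (intro fundamental_theorem_of_calculus)
      (auto intro: has_vector_derivative_within_subset[OF F_time])
  from has_integral_neg[OF this] have "((\<lambda>s. V (F s x)) has_integral (x - F t x)) {0..t}"
    by (simp add: init)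
  then have "integral {0..t} (\<lambda>s. V (F s x)) = x - F t x" by (rule integral_unique)
  then show ?thesis by simp
qed

lemma G_integral:
  assumes t: "0 \<le> t"
  shows "G t x = id_blinfun - integral {0..t} (\<lambda>s. V' (F s x) o\<^sub>L G s x)"
proof -
  have "((\<lambda>x. integral (cbox 0 t) (\<lambda>s. V (F s x))) has_derivative
      blinfun_apply (integral (cbox 0 t) (\<lambda>s. V' (F s x) o\<^sub>L G s x))) (at x within UNIV)"
  proof (rule leibniz_rule)
    show "((\<lambda>x. V (F s x)) has_derivative blinfun_apply (V' (F s x) o\<^sub>L G s x)) (at x within UNIV)"
      if "s \<in> cbox 0 t" for s x
    proof -
      have "0 \<le> s" using that by simp
      from has_derivative_compose[OF F_deriv_space[OF this] V_deriv]
      show ?thesis by (simp add: blinfun_apply_blinfun_compose[abs_def])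
    qed
    show "(\<lambda>s. V (F s x)) integrable_on cbox 0 t" for x
      by (intro integrable_continuous flow_continuous_intros continuous_intros) auto
    show "continuous_on (UNIV \<times> cbox 0 t) (\<lambda>(x, s). V' (F s x) o\<^sub>L G s x)"
      unfolding split_def by (intro flow_continuous_intros continuous_intros) auto
  qed auto
  then have "((\<lambda>x. x - integral (cbox 0 t) (\<lambda>s. V (F s x))) has_derivative
      (\<lambda>v. v - integral (cbox 0 t) (\<lambda>s. V' (F s x) o\<^sub>L G s x) v)) (at x)"
    by (auto intro!: derivative_eq_intros)
  moreover have "(\<lambda>x. x - integral (cbox 0 t) (\<lambda>s. V (F s x))) = F t"
    using F_integral[OF t] by auto
  ultimately have "(F t has_derivative
      (\<lambda>v. v - integral (cbox 0 t) (\<lambda>s. V' (F s x) o\<^sub>L G s x) v)) (at x)" by simp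
  then have "(\<lambda>v. v - integral (cbox 0 t) (\<lambda>s. V' (F s x) o\<^sub>L G s x) v) = G t x"
    using F_deriv_space[OF t] by (rule has_derivative_unique)
  from fun_cong[OF this] show ?thesis by (intro blinfun_eqI) (simp add: blinfun.diff_left)
qed

lemma G_time:
  assumes t: "0 \<le> t"
  shows "((\<lambda>t. G t x w) has_vector_derivative - V' (F t x) (G t x w)) (at t within {0..})"
proof -
  have "((\<lambda>t. integral {0..t} (\<lambda>s. V' (F s x) o\<^sub>L G s x)) has_vector_derivative
      V' (F t x) o\<^sub>L G t x) (at t within {0..t + 1})"
    using t by (intro integral_has_vector_derivative flow_continuous_intros continuous_intros) auto
  then have "((\<lambda>t. integral {0..t} (\<lambda>s. V' (F s x) o\<^sub>L G s x)) has_vector_derivative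
      V' (F t x) o\<^sub>L G t x) (at t within {0..})"
    by (subst (asm) at_within_nhd[of t "{..<t + 1}" _ "{0..}"]) auto
  then have "((\<lambda>t. (id_blinfun - integral {0..t} (\<lambda>s. V' (F s x) o\<^sub>L G s x)) w)
      has_vector_derivative (0 - (V' (F t x) o\<^sub>L G t x)) w) (at t within {0..})"
    by (intro bounded_linear.has_vector_derivative[OF blinfun.bounded_linear_left]
        has_vector_derivative_diff has_vector_derivative_const)
  then have "((\<lambda>t. (id_blinfun - integral {0..t} (\<lambda>s. V' (F s x) o\<^sub>L G s x)) w)
      has_vector_derivative - V' (F t x) (G t x w)) (at t within {0..})"
    by (simp add: blinfun.diff_left blinfun.minus_left)
  then show ?thesis
    by (rule has_vector_derivative_transform[rotated 2]) (use t G_integral in auto)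
qed

end

section \<open>Symplecticity and regularity of the linearised flow\<close>

text \<open>Transport along a Hamiltonian field: \<open>J\<close> is a complex structure that is skew for the inner
  product, and the last assumption says that \<open>J V'\<close> is symmetric, as it is for \<open>V = J grad H\<close>.\<close>

locale hamiltonian_transport = transport +
  fixes J :: "'a \<Rightarrow> 'a"
  assumes J_linear: "linear J"
    and J_J: "\<And>u. J (J u) = - u"
    and J_skew: "\<And>u v. J u \<bullet> v = - (u \<bullet> J v)"
    and V'_hamiltonian: "\<And>x u v. J (V' x u) \<bullet> v = J (V' x v) \<bullet> u"
begin

lemma J_bounded_linear: "bounded_linear J"
  using J_linear by (rule linear_conv_bounded_linear[THEN iffD1])

lemmas continuous_on_J = bounded_linear.continuous_on[OF J_bounded_linear]

text \<open>The pairing compares the linearised flows at two base points: for \<open>x = y\<close> its derivative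
  vanishes, which is the invariance of the symplectic form, and for \<open>x \<noteq> y\<close> it measures the difference
  of the coefficients.\<close>

lemma form_deriv:
  assumes "0 \<le> t"
  shows "((\<lambda>t. J (G t x u) \<bullet> G t y w) has_vector_derivative
    J (G t x u) \<bullet> (V' (F t x) - V' (F t y)) (G t y w)) (at t within {0..})"
proof -
  have "((\<lambda>t. J (G t x u) \<bullet> G t y w) has_vector_derivative
     J (G t x u) \<bullet> (- V' (F t y) (G t y w)) + J (- V' (F t x) (G t x u)) \<bullet> G t y w) (at t within {0..})"
    by (intro bounded_bilinear.has_vector_derivative[OF bounded_bilinear_inner] G_time assms
        bounded_linear.has_vector_derivative[OF J_bounded_linear])
  moreover have "J (- V' (F t x) (G t x u)) \<bullet> G t y w = J (G t x u) \<bullet> V' (F t x) (G t y w)"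
  proof -
    have "J (- V' (F t x) (G t x u)) \<bullet> G t y w = - (J (V' (F t x) (G t y w)) \<bullet> G t x u)"
      by (simp add: linear_neg[OF J_linear] V'_hamiltonian[of _ "G t x u"])
    also have "\<dots> = V' (F t x) (G t y w) \<bullet> J (G t x u)" by (simp add: J_skew)
    finally show ?thesis by (simp add: inner_commute)
  qed
  ultimately show ?thesis by (simp add: blinfun.diff_left inner_diff_right)
qed

text \<open>The time interval is rescaled to the unit interval, so that the integral depends on \<open>t\<close> only
  through its integrand.\<close>

lemma form_integral:
  assumes t: "0 \<le> t"
  shows "J (G t x u) \<bullet> G t y w = J u \<bullet> w + integral (cbox 0 1)
    (\<lambda>r. t * (J (G (t * r) x u) \<bullet> (V' (F (t * r) x) - V' (F (t * r) y)) (G (t * r) y w)))"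
proof -
  let ?q = "\<lambda>t. J (G t x u) \<bullet> G t y w"
  have "((\<lambda>r. t * (J (G (t * r) x u) \<bullet> (V' (F (t * r) x) - V' (F (t * r) y)) (G (t * r) y w)))
      has_integral (?q (t * 1) - ?q (t * 0))) {0..1}"
  proof (rule fundamental_theorem_of_calculus)
    fix r :: real assume r: "r \<in> {0..1}"
    have "(?q \<circ> (\<lambda>r. t * r) has_vector_derivative t *\<^sub>R
       (J (G (t * r) x u) \<bullet> (V' (F (t * r) x) - V' (F (t * r) y)) (G (t * r) y w))) (at r within {0..1})"
    proof (rule vector_diff_chain_within)
      show "((*) t has_vector_derivative t) (at r within {0..1})"
        by (auto intro!: derivative_eq_intros simp: has_vector_derivative_def)
      show "(?q has_vector_derivative
       (J (G (t * r) x u) \<bullet> (V' (F (t * r) x) - V' (F (t * r) y)) (G (t * r) y w)))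
       (at (t * r) within (*) t ` {0..1})"
        by (rule has_vector_derivative_within_subset[OF form_deriv]) (use t r in auto)
    qed
    then show "((\<lambda>r. ?q (t * r)) has_vector_derivative t *
       (J (G (t * r) x u) \<bullet> (V' (F (t * r) x) - V' (F (t * r) y)) (G (t * r) y w))) (at r within {0..1})"
      by (simp add: o_def)
  qed simp
  from integral_unique[OF this] show ?thesis by (simp add: G_init)
qed

lemma symplectic:
  assumes "0 \<le> t"
  shows "J (G t x u) \<bullet> G t x w = J u \<bullet> w"
  using form_integral[OF assms, of x u x w] by simp

text \<open>The right inverse of \<open>J \<circ> G t x\<close> provided by symplecticity, written as an explicit expression in
  \<open>G\<close> so that its continuity is evident.\<close>

definition G_inv :: "real \<Rightarrow> 'a \<Rightarrow> 'a \<Rightarrow> 'a" where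
  "G_inv t x e = - (\<Sum>b\<in>Basis. (G t x b \<bullet> e) *\<^sub>R J b)"

lemma J_G_inv:
  assumes t: "0 \<le> t"
  shows "J (G t x (G_inv t x e)) = e"
proof -
  have lin: "linear (\<lambda>v. J (G t x v))"
    by (rule linearI) (simp_all add: blinfun.add_right blinfun.scaleR_right
        linear_add[OF J_linear] linear_scale[OF J_linear])
  have lin': "linear (G_inv t x)"
    unfolding G_inv_def
    by (rule linearI) (simp_all add: inner_add_right scaleR_add_left sum.distrib scaleR_right.sum)
  have "G_inv t x (J (G t x v)) = v" for v
  proof -
    have "G_inv t x (J (G t x v)) = - (\<Sum>b\<in>Basis. (J v \<bullet> b) *\<^sub>R J b)"
      unfolding G_inv_def by (simp add: inner_commute[of _ "J _"] symplectic[OF t])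
    also have "\<dots> = - J (\<Sum>b\<in>Basis. (J v \<bullet> b) *\<^sub>R b)"
      by (simp add: linear_sum[OF J_linear] linear_scale[OF J_linear])
    also have "\<dots> = v" by (simp add: euclidean_representation J_J)
    finally show ?thesis .
  qed
  then have "G_inv t x \<circ> (\<lambda>v. J (G t x v)) = id" by auto
  then have "(\<lambda>v. J (G t x v)) \<circ> G_inv t x = id" using linear_inverse_left[OF lin lin'] by simp
  then show ?thesis by (auto dest: fun_cong)
qed

text \<open>The transpose of \<open>G t x\<close> is symplectic as well.\<close>

lemma dual_symplectic:
  assumes t: "0 \<le> t"
  shows "(\<Sum>b\<in>Basis. (G t x b \<bullet> u) * (G t x (J b) \<bullet> v)) = J u \<bullet> v"
proof -
  have "J u = J (J (G t x (G_inv t x u)))" using J_G_inv[OF t] by simp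
  also have "\<dots> = (\<Sum>b\<in>Basis. (G t x b \<bullet> u) *\<^sub>R G t x (J b))"
    by (simp add: J_J G_inv_def blinfun.minus_right blinfun.sum_right blinfun.scaleR_right)
  finally show ?thesis by (simp add: inner_sum_left)
qed

text \<open>The derivative in \<open>y\<close> of the integrand of \<open>form_integral\<close>, with the vector \<open>G (t * r) y w\<close>
  frozen at a further base point \<open>z\<close>.\<close>

definition variation_kernel :: "real \<Rightarrow> 'a \<Rightarrow> 'a \<Rightarrow> 'a \<Rightarrow> 'a \<Rightarrow> 'a \<Rightarrow> real \<Rightarrow> 'a \<Rightarrow>\<^sub>L real" where
  "variation_kernel t x u w z y r = (- t) *\<^sub>R (blinfun_inner_right (J (G (t * r) x u)) o\<^sub>L
     (blinfun.prod_left (G (t * r) z w) o\<^sub>L (V'' (F (t * r) y) o\<^sub>L G (t * r) y)))"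

lemma variation_kernel_apply:
  "variation_kernel t x u w z y r v =
    - t * (J (G (t * r) x u) \<bullet> V'' (F (t * r) y) (G (t * r) y v) (G (t * r) z w))"
  by (simp add: variation_kernel_def blinfun.scaleR_left blinfun.minus_left blinfun_inner_right.rep_eq blinfun.prod_left.rep_eq)

lemma continuous_on_variation_kernel:
  fixes t r :: "'c::topological_space \<Rightarrow> real"
  assumes "continuous_on S t" "continuous_on S x" "continuous_on S u" "continuous_on S z"
    "continuous_on S y" "continuous_on S r"
    and "\<And>p. p \<in> S \<Longrightarrow> 0 \<le> t p \<and> 0 \<le> r p"
  shows "continuous_on S (\<lambda>p. variation_kernel (t p) (x p) (u p) w (z p) (y p) (r p))"
  unfolding variation_kernel_def
  by (intro continuous_on_scaleR flow_continuous_intros continuous_on_minus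
      bounded_linear.continuous_on[OF bounded_linear_blinfun_inner_right]
      bounded_linear.continuous_on[OF blinfun.bounded_linear_prod_left]
      continuous_on_J blinfun.continuous_on continuous_on_mult assms continuous_on_const)
    (use assms in auto)

lemma continuous_on_G_inv:
  fixes p :: "'c::topological_space \<Rightarrow> real"
  assumes "continuous_on S p" "continuous_on S q" "\<And>z. z \<in> S \<Longrightarrow> 0 \<le> p z"
  shows "continuous_on S (\<lambda>z. G_inv (p z) (q z) e)"
  unfolding G_inv_def
  by (intro continuous_intros blinfun.continuous_on continuous_on_G assms)

text \<open>The derivative of the entry \<open>G t x w \<bullet> e\<close> with respect to \<open>x\<close>.\<close>

definition G_space_deriv :: "real \<Rightarrow> 'a \<Rightarrow> 'a \<Rightarrow> 'a \<Rightarrow> 'a \<Rightarrow>\<^sub>L real" where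
  "G_space_deriv t x w e = integral (cbox 0 1) (variation_kernel t x (G_inv t x e) w x x)"

lemma G_has_space_deriv:
  assumes t: "0 \<le> t"
  shows "((\<lambda>y. G t y w \<bullet> e) has_derivative G_space_deriv t x w e) (at x)"
proof -
  define u where "u = G_inv t x e"
  \<comment> \<open>The factor \<open>G (t * r) y w\<close> is only known to be continuous in \<open>y\<close>, so its base point is
    renamed \<open>z\<close>. Since \<open>\<Gamma> z x = 0\<close> for all \<open>z\<close>, differentiability of \<open>\<Gamma>\<close> at
    \<open>(x, x)\<close> requires differentiability in \<open>y\<close> only.\<close>
  define \<Gamma> where "\<Gamma> z y = integral (cbox 0 1)
    (\<lambda>r. t * (J (G (t * r) x u) \<bullet> (V' (F (t * r) x) - V' (F (t * r) y)) (G (t * r) z w)))" for z y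
  have leibniz: "(\<Gamma> z has_derivative integral (cbox 0 1) (variation_kernel t x u w z y)) (at y within UNIV)" for z y
    unfolding \<Gamma>_def
  proof (rule leibniz_rule)
    fix y and r :: real
    assume r: "r \<in> cbox 0 1"
    have V': "((\<lambda>y. V' (F (t * r) y)) has_derivative
        (\<lambda>v. V'' (F (t * r) y) (G (t * r) y v))) (at y)"
      using r t by (intro has_derivative_compose[OF F_deriv_space V'_deriv]) auto
    have "((\<lambda>y. t * (J (G (t * r) x u) \<bullet> (V' (F (t * r) x) - V' (F (t * r) y)) (G (t * r) z w)))
      has_derivative (\<lambda>v. t * (J (G (t * r) x u) \<bullet>
        (0 - V'' (F (t * r) y) (G (t * r) y v)) (G (t * r) z w)))) (at y)"
      by (intro has_derivative_mult_right has_derivative_inner_right has_derivative_diff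
          has_derivative_const V' bounded_linear.has_derivative[OF blinfun.bounded_linear_left])
    then show "((\<lambda>y. t * (J (G (t * r) x u) \<bullet> (V' (F (t * r) x) - V' (F (t * r) y)) (G (t * r) z w)))
      has_derivative variation_kernel t x u w z y r) (at y within UNIV)"
      by (simp add: variation_kernel_apply[abs_def] blinfun.minus_left)
  next
    show "(\<lambda>r. t * (J (G (t * r) x u) \<bullet> (V' (F (t * r) x) - V' (F (t * r) y)) (G (t * r) z w)))
      integrable_on cbox 0 1" for y
      using t by (intro integrable_continuous flow_continuous_intros continuous_on_J continuous_intros
          blinfun.continuous_on) auto
    show "continuous_on (UNIV \<times> cbox 0 1) (\<lambda>(y, r). variation_kernel t x u w z y r)"
      unfolding split_def using t by (intro continuous_on_variation_kernel continuous_intros) auto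
  qed auto
  have "((\<lambda>(z, y). \<Gamma> z y) has_derivative
      (\<lambda>(tz, ty). 0 + integral (cbox 0 1) (variation_kernel t x u w x x) ty)) (at (x, x) within UNIV \<times> UNIV)"
  proof (rule has_derivative_partialsI[where fx = "\<lambda>_. 0" and
        fy = "\<lambda>z y. integral (cbox 0 1) (variation_kernel t x u w z y)"])
    have "\<Gamma> z x = 0" for z by (simp add: \<Gamma>_def)
    then show "((\<lambda>z. \<Gamma> z x) has_derivative (\<lambda>_. 0)) (at x within UNIV)" by simp
    have "continuous_on (UNIV \<times> UNIV) (\<lambda>zy. integral (cbox 0 1) (variation_kernel t x u w (fst zy) (snd zy)))"
      using t by (intro integral_continuous_on_param)
        (auto simp: split_def intro!: continuous_on_variation_kernel continuous_intros)
    then show "continuous (at (x, x) within UNIV \<times> UNIV)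
       (\<lambda>(z, y). integral (cbox 0 1) (variation_kernel t x u w z y))"
      by (simp add: split_def continuous_on_eq_continuous_within)
  qed (use leibniz in auto)
  then have "((\<lambda>(z, y). \<Gamma> z y) has_derivative
      (\<lambda>(tz, ty). 0 + integral (cbox 0 1) (variation_kernel t x u w x x) ty)) (at (x, x))" by simp
  from has_derivative_compose[OF has_derivative_Pair[OF has_derivative_ident has_derivative_ident] this]
  have "((\<lambda>y. J u \<bullet> w + \<Gamma> y y) has_derivative integral (cbox 0 1) (variation_kernel t x u w x x)) (at x)"
    by (auto intro!: derivative_eq_intros)
  moreover have "G t y w \<bullet> e = J u \<bullet> w + \<Gamma> y y" for y
    using form_integral[OF t, of x u y w] J_G_inv[OF t, of x e]
    by (simp add: \<Gamma>_def u_def inner_commute)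
  ultimately show ?thesis by (simp add: G_space_deriv_def u_def)
qed

lemma G_has_derivative:
  assumes t: "0 \<le> t"
  shows "((\<lambda>(t, x). G t x w \<bullet> e) has_derivative
    (\<lambda>(h, v). h * (- V' (F t x) (G t x w) \<bullet> e) + G_space_deriv t x w e v)) (at (t, x) within {0..} \<times> UNIV)"
proof (rule has_derivative_partialsI[where fy = "\<lambda>t x. G_space_deriv t x w e"])
  have "((\<lambda>t. G t x w \<bullet> e) has_vector_derivative - V' (F t x) (G t x w) \<bullet> e) (at t within {0..})"
    using bounded_linear.has_vector_derivative[OF bounded_linear_inner_left G_time[OF t]] .
  then show "((\<lambda>t. G t x w \<bullet> e) has_derivative (\<lambda>h. h * (- V' (F t x) (G t x w) \<bullet> e))) (at t within {0..})"
    by (simp add: has_vector_derivative_def)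
  have "continuous_on ({0..} \<times> UNIV) (\<lambda>z. G_space_deriv (fst z) (snd z) w e)"
    unfolding G_space_deriv_def
    by (intro integral_continuous_on_param)
      (auto simp: split_def intro!: continuous_on_variation_kernel continuous_on_G_inv continuous_intros)
  then show "continuous (at (t, x) within {0..} \<times> UNIV) (\<lambda>(t, x). G_space_deriv t x w e)"
    using t by (simp add: split_def continuous_on_eq_continuous_within)
qed (use G_has_space_deriv in auto)

lemma G_C1: "C1_on ({0..} \<times> UNIV) (\<lambda>(t, x). G t x w \<bullet> e)"
proof (rule C1_onI)
  fix z :: "real \<times> 'a" assume "z \<in> {0..} \<times> UNIV"
  then show "((\<lambda>(t, x). G t x w \<bullet> e) has_derivative
    (\<lambda>z (h, v). h * (- V' (F (fst z) (snd z)) (G (fst z) (snd z) w) \<bullet> e)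
      + G_space_deriv (fst z) (snd z) w e v) z) (at z within {0..} \<times> UNIV)"
    using G_has_derivative[of "fst z" w e "snd z"] by auto
next
  fix v :: "real \<times> 'a"
  show "continuous_on ({0..} \<times> UNIV) (\<lambda>z. (\<lambda>(h, v). h * (- V' (F (fst z) (snd z)) (G (fst z) (snd z) w) \<bullet> e)
      + G_space_deriv (fst z) (snd z) w e v) v)"
    unfolding G_space_deriv_def split_def
    by (intro continuous_intros blinfun.continuous_on flow_continuous_intros
        integral_continuous_on_param)
      (auto simp: split_def intro!: continuous_on_variation_kernel continuous_on_G_inv continuous_intros)
qed

text \<open>The transport operator applied to \<open>G w\<close>, obtained by differentiating the cocycle identity in
  the inner time at \<open>0\<close>; in this way no mixed second derivatives in time and space occur.\<close>

lemma G_transport: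
  assumes t: "0 \<le> t"
    and D: "((\<lambda>(t, x). G t x w \<bullet> e) has_derivative D) (at (t, x) within {0..} \<times> UNIV)"
  shows "D (1, V x) = - (G t x (V' x w) \<bullet> e)"
proof -
  let ?D = "\<lambda>w. G_space_deriv t x w e"
  \<comment> \<open>At \<open>t = 0\<close> the derivative within the half space is still unique, because rays with
    \<open>h \<ge> 0\<close> determine it.\<close>
  have D_slice: "D (h, v) = h * (- V' (F t x) (G t x w) \<bullet> e) + ?D w v" for h v
  proof -
    note ray = has_vector_derivative_ray[OF _ t]
    have eq: "D (k, v) = k * (- V' (F t x) (G t x w) \<bullet> e) + ?D w v" if "0 \<le> k" for k v
      using vector_derivative_unique_within[OF _ ray[OF D that, of v] ray[OF G_has_derivative[OF t] that]]
      by (simp add: at_within_Ici_at_right)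
    have "linear D" using D by (rule has_derivative_linear)
    from linear_neg[OF this, of "(h, v)"] have "D (h, v) = - D (- h, - v)" by simp
    then show ?thesis using eq[of h v] eq[of "- h" "- v"] by (cases "0 \<le> h") (auto simp: blinfun.minus_right)
  qed
  have expand: "G t y z \<bullet> e = (\<Sum>b\<in>Basis. (z \<bullet> b) * (G t y b \<bullet> e))" for y z
  proof -
    have "G t y z = G t y (\<Sum>b\<in>Basis. (z \<bullet> b) *\<^sub>R b)" by (simp add: euclidean_representation)
    then show ?thesis by (simp add: blinfun.sum_right blinfun.scaleR_right inner_sum_left)
  qed
  have D_lin: "?D w v = (\<Sum>b\<in>Basis. (w \<bullet> b) * ?D b v)" for v
  proof -
    have "((\<lambda>y. \<Sum>b\<in>Basis. (w \<bullet> b) * (G t y b \<bullet> e)) has_derivative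
        (\<lambda>v. \<Sum>b\<in>Basis. (w \<bullet> b) * ?D b v)) (at x)"
      by (intro has_derivative_sum has_derivative_mult_right G_has_space_deriv t)
    then have "((\<lambda>y. G t y w \<bullet> e) has_derivative (\<lambda>v. \<Sum>b\<in>Basis. (w \<bullet> b) * ?D b v)) (at x)"
      by (simp add: expand[of _ w])
    then have "blinfun_apply (?D w) = (\<lambda>v. \<Sum>b\<in>Basis. (w \<bullet> b) * ?D b v)"
      using G_has_space_deriv[OF t] by (rule has_derivative_unique[rotated])
    then show ?thesis by simp
  qed
  have "((\<lambda>s. G (t + s) x w \<bullet> e) has_vector_derivative - V' (F t x) (G t x w) \<bullet> e) (at 0 within {0..})"
    using has_vector_derivative_ray[OF G_has_derivative[OF t] t, of 1 w e x 0] by simp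
  moreover have "((\<lambda>s. G (t + s) x w \<bullet> e) has_vector_derivative
      (\<Sum>b\<in>Basis. (w \<bullet> b) * ?D b (- V x) + (- V' x w \<bullet> b) * (G t x b \<bullet> e))) (at 0 within {0..})"
  proof (rule has_vector_derivative_transform)
    show "G (t + s) x w \<bullet> e = (\<Sum>b\<in>Basis. (G s x w \<bullet> b) * (G t (F s x) b \<bullet> e))" if "s \<in> {0..}" for s
      using that t by (simp add: G_cocycle expand[of _ "G s x w"])
    have F: "((\<lambda>s. F s x) has_derivative (\<lambda>h. h *\<^sub>R (- V x))) (at 0 within {0..})"
      using F_time[of 0 x] by (simp add: has_vector_derivative_def init)
    have "((\<lambda>s. G t (F s x) b \<bullet> e) has_vector_derivative ?D b (- V x)) (at 0 within {0..})" for b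
      using has_derivative_compose[OF F, of "\<lambda>y. G t y b \<bullet> e" "?D b"] G_has_space_deriv[OF t, of b e x]
      by (simp add: has_vector_derivative_def init blinfun.scaleR_right blinfun.minus_right)
    moreover have "((\<lambda>s. G s x w \<bullet> b) has_vector_derivative - V' x w \<bullet> b) (at 0 within {0..})" for b
      using bounded_linear.has_vector_derivative[OF bounded_linear_inner_left G_time[of 0 x w]]
      by (simp add: init G_init)
    ultimately show "((\<lambda>s. \<Sum>b\<in>Basis. (G s x w \<bullet> b) * (G t (F s x) b \<bullet> e)) has_vector_derivative
      (\<Sum>b\<in>Basis. (w \<bullet> b) * ?D b (- V x) + (- V' x w \<bullet> b) * (G t x b \<bullet> e))) (at 0 within {0..})"
      by (intro has_vector_derivative_sum)
        (use bounded_bilinear.has_vector_derivative[OF bounded_bilinear_mult] in \<open>fastforce simp: init G_init\<close>)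
  qed auto
  ultimately have "- V' (F t x) (G t x w) \<bullet> e =
      (\<Sum>b\<in>Basis. (w \<bullet> b) * ?D b (- V x) + (- V' x w \<bullet> b) * (G t x b \<bullet> e))"
    by (rule vector_derivative_unique_within[rotated]) (simp add: at_within_Ici_at_right)
  also have "\<dots> = - ?D w (V x) - G t x (V' x w) \<bullet> e"
    by (simp add: sum.distrib D_lin expand[of _ "V' x w"] blinfun.minus_right sum_negf sum_subtractf)
  finally show ?thesis using D_slice[of 1 "V x"] by simp
qed

end

section \<open>Hamiltonian vector fields and the Liouville operator\<close>

text \<open>The first two derivatives, as continuous functions with values in bounded linear maps, of a
  vector field with smooth components.\<close>

lemma smooth_field_derivatives:
  fixes a :: "'a::euclidean_space \<Rightarrow> 'a \<Rightarrow> real"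
  assumes smooth: "\<And>i. smooth (a i)"
  obtains V' :: "'a \<Rightarrow> 'a \<Rightarrow>\<^sub>L 'a" and V'' :: "'a \<Rightarrow> 'a \<Rightarrow>\<^sub>L ('a \<Rightarrow>\<^sub>L 'a)"
  where "\<And>x. ((\<lambda>x. \<Sum>i\<in>Basis. a i x *\<^sub>R i) has_derivative V' x) (at x)"
    and "\<And>x. (V' has_derivative V'' x) (at x)"
    and "continuous_on UNIV V''"
    and "\<And>x u. V' x u = (\<Sum>i\<in>Basis. frechet_derivative (a i) (at x) u *\<^sub>R i)"
proof -
  define m where "m = (\<lambda>i j x. frechet_derivative (a i) (at x) j)"
  have m: "smooth (m i j)" for i j unfolding m_def by (intro smooth_frechet_derivative smooth)
  define E :: "'a \<Rightarrow> 'a \<Rightarrow> 'a \<Rightarrow>\<^sub>L 'a"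
    where "E = (\<lambda>i j. blinfun_scaleR_left i o\<^sub>L blinfun_inner_left j)"
  have E: "E i j u = (u \<bullet> j) *\<^sub>R i" for i j u
    by (simp add: E_def blinfun_inner_left.rep_eq)
  define m' where "m' = (\<lambda>i j x. Blinfun (frechet_derivative (m i j) (at x)))"
  have m': "blinfun_apply (m' i j x) = frechet_derivative (m i j) (at x)" for i j x
    unfolding m'_def
    by (intro bounded_linear_Blinfun_apply has_derivative_bounded_linear[OF smooth_has_derivative] m)
  define V' where "V' = (\<lambda>x. \<Sum>i\<in>Basis. \<Sum>j\<in>Basis. m i j x *\<^sub>R E i j)"
  define V'' where "V'' = (\<lambda>x. \<Sum>i\<in>Basis. \<Sum>j\<in>Basis. blinfun_scaleR_left (E i j) o\<^sub>L m' i j x)"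
  have V'_eq: "V' x u = (\<Sum>i\<in>Basis. frechet_derivative (a i) (at x) u *\<^sub>R i)" for x u
  proof -
    have lin: "linear (frechet_derivative (a i) (at x))" for i
      by (rule has_derivative_linear[OF smooth_has_derivative[OF smooth]])
    have "frechet_derivative (a i) (at x) u = (\<Sum>j\<in>Basis. (u \<bullet> j) * m i j x)" for i
    proof -
      have "frechet_derivative (a i) (at x) u
          = frechet_derivative (a i) (at x) (\<Sum>j\<in>Basis. (u \<bullet> j) *\<^sub>R j)"
        by (simp add: euclidean_representation)
      then show ?thesis by (simp add: linear_sum[OF lin] linear_scale[OF lin] m_def)
    qed
    then show ?thesis
      by (simp add: V'_def blinfun.sum_left blinfun.scaleR_left E scaleR_sum_left mult.commute)
  qed
  show thesis
  proof (rule that[of V' V''])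
    show "((\<lambda>x. \<Sum>i\<in>Basis. a i x *\<^sub>R i) has_derivative V' x) (at x)" for x
      unfolding V'_eq[abs_def]
      by (intro has_derivative_sum has_derivative_scaleR_left smooth_has_derivative smooth)
    have "((\<lambda>x. \<Sum>i\<in>Basis. \<Sum>j\<in>Basis. m i j x *\<^sub>R E i j) has_derivative
      (\<lambda>v. \<Sum>i\<in>Basis. \<Sum>j\<in>Basis. frechet_derivative (m i j) (at x) v *\<^sub>R E i j)) (at x)" for x
      by (intro has_derivative_sum has_derivative_scaleR_left smooth_has_derivative m)
    then show "(V' has_derivative V'' x) (at x)" for x
      by (simp add: V'_def V''_def m' blinfun.sum_left[abs_def])
    show "continuous_on UNIV V''"
    proof (rule continuous_on_blinfun_componentwise)
      fix v :: 'a
      show "continuous_on UNIV (\<lambda>x. V'' x v)"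
        unfolding V''_def
        by (simp add: blinfun.sum_left m')
          (intro continuous_on_sum continuous_on_scaleR continuous_on_const smooth_continuous
            smooth_frechet_derivative m)
    qed
  qed (rule V'_eq)
qed

text \<open>The complex structure of phase space; the Hamiltonian field is \<open>phase_J\<close> applied to the
  gradient of \<open>H\<close>.\<close>

definition phase_J :: "'n::finite phase \<Rightarrow> 'n phase" where
  "phase_J X = (snd X, - fst X)"

lemma linear_phase_J: "linear phase_J"
  by (rule linearI) (simp_all add: phase_J_def)

lemma sum_Basis_vec:
  fixes f :: "real ^ 'n::finite \<Rightarrow> real"
  shows "(\<Sum>b\<in>Basis. f b) = (\<Sum>i\<in>UNIV. f (axis i 1))"
proof -
  have B: "(Basis :: (real ^ 'n) set) = range (\<lambda>i. axis i 1)" by (auto simp: Basis_vec_def)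
  have "inj (\<lambda>i :: 'n. axis i (1 :: real))" by (auto simp: inj_on_def axis_eq_axis)
  then show ?thesis unfolding B by (subst sum.reindex) (simp_all add: o_def)
qed

lemma sum_Basis_phase:
  fixes f :: "'n::finite phase \<Rightarrow> real"
  shows
  "(\<Sum>b\<in>Basis. f b) = (\<Sum>i\<in>UNIV. f (axis i 1, 0)) + (\<Sum>i\<in>UNIV. f (0, axis i 1))"
proof -
  have "inj_on (\<lambda>u. (u, 0) :: 'n phase) Basis" "inj_on (\<lambda>u. (0, u) :: 'n phase) Basis"
    by (auto simp: inj_on_def)
  then show ?thesis
    unfolding Basis_prod_def
    by (subst sum.union_disjoint) (auto simp: sum.reindex sum_Basis_vec)
qed

text \<open>The field \<open>V = (H\<^sub>p, - H\<^sub>x)\<close>.\<close>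

definition hfield :: "('n::finite phase \<Rightarrow> real) \<Rightarrow> 'n phase \<Rightarrow> 'n phase" where
  "hfield H X = ((\<chi> i. dp i H X), - (\<chi> i. dx i H X))"

lemma dx_eq:
  fixes f :: "'n::finite phase \<Rightarrow> 'b::real_normed_vector"
  assumes "(f has_derivative D) (at X)"
  shows "dx i f X = D (axis i 1, 0)"
proof -
  have "((\<lambda>s. f (fst X + s *\<^sub>R axis i 1, snd X)) has_derivative (\<lambda>h. D (h *\<^sub>R axis i 1, 0))) (at 0)"
    by (rule has_derivative_compose[where f = "\<lambda>s. (fst X + s *\<^sub>R axis i 1, snd X)" and g = f])
      (use assms in \<open>auto intro!: derivative_eq_intros\<close>)
  moreover have "(\<lambda>h. D (h *\<^sub>R axis i 1, 0)) = (\<lambda>h. h *\<^sub>R D (axis i 1, 0))"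
    using linear_scale[OF has_derivative_linear[OF assms], of _ "(axis i 1, 0)"] by auto
  ultimately show ?thesis
    unfolding dx_def by (intro vector_derivative_at) (simp only: has_vector_derivative_def)
qed

lemma dp_eq:
  fixes f :: "'n::finite phase \<Rightarrow> 'b::real_normed_vector"
  assumes "(f has_derivative D) (at X)"
  shows "dp i f X = D (0, axis i 1)"
proof -
  have "((\<lambda>s. f (fst X, snd X + s *\<^sub>R axis i 1)) has_derivative (\<lambda>h. D (0, h *\<^sub>R axis i 1))) (at 0)"
    by (rule has_derivative_compose[where f = "\<lambda>s. (fst X, snd X + s *\<^sub>R axis i 1)" and g = f])
      (use assms in \<open>auto intro!: derivative_eq_intros\<close>)
  moreover have "(\<lambda>h. D (0, h *\<^sub>R axis i 1)) = (\<lambda>h. h *\<^sub>R D (0, axis i 1))"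
    using linear_scale[OF has_derivative_linear[OF assms], of _ "(0, axis i 1)"] by auto
  ultimately show ?thesis
    unfolding dp_def by (intro vector_derivative_at) (simp only: has_vector_derivative_def)
qed

lemma dx_smooth:
  assumes "smooth f"
  shows "dx i f = (\<lambda>X. frechet_derivative f (at X) (axis i 1, 0))"
  using dx_eq[OF smooth_has_derivative[OF assms]] by auto

lemma dp_smooth:
  assumes "smooth f"
  shows "dp i f = (\<lambda>X. frechet_derivative f (at X) (0, axis i 1))"
  using dp_eq[OF smooth_has_derivative[OF assms]] by auto

lemma smooth_dx: "smooth f \<Longrightarrow> smooth (dx i f)" and smooth_dp: "smooth f \<Longrightarrow> smooth (dp i f)"
  by (simp_all add: dx_smooth dp_smooth smooth_frechet_derivative)

lemma continuous_on_Hxp: "smooth H \<Longrightarrow> continuous_on UNIV (Hxp H)"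
  unfolding Hxp_def by (intro continuous_on_vec_lambda continuous_on_of_real)
    (auto intro: smooth_continuous smooth_dx smooth_dp)

lemma continuous_on_Hpx: "smooth H \<Longrightarrow> continuous_on UNIV (Hpx H)"
  unfolding Hpx_def Hxp_def transpose_def vec_lambda_beta
  by (intro continuous_on_vec_lambda continuous_on_of_real)
    (auto intro: smooth_continuous smooth_dx smooth_dp)

lemma continuous_on_Hpp: "smooth H \<Longrightarrow> continuous_on UNIV (Hpp H)"
  unfolding Hpp_def by (intro continuous_on_vec_lambda continuous_on_of_real)
    (auto intro: smooth_continuous smooth_dp)

lemma hfield_eq:
  fixes H :: "'n::finite phase \<Rightarrow> real"
  assumes "smooth H"
  shows "hfield H = (\<lambda>X. \<Sum>b\<in>Basis. frechet_derivative H (at X) (- phase_J b) *\<^sub>R b)"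
proof
  fix X :: "'n phase"
  let ?D = "frechet_derivative H (at X)"
  have H: "(H has_derivative ?D) (at X)" using assms by (rule smooth_has_derivative)
  have "hfield H X \<bullet> b = ?D (- phase_J b)" if "b \<in> Basis" for b
  proof -
    from that consider i where "b = (axis i 1, 0)" | i where "b = (0, axis i 1)"
      by (auto simp: Basis_prod_def Basis_vec_def)
    then show ?thesis
    proof cases
      case 1
      then show ?thesis by (simp add: hfield_def phase_J_def inner_prod_def inner_axis dp_eq[OF H])
    next
      case 2
      have "- phase_J b = - (axis i 1, 0)" using 2 by (simp add: phase_J_def)
      then have "?D (- phase_J b) = - ?D (axis i 1, 0)"
        using linear_neg[OF has_derivative_linear[OF H], of "(axis i 1, 0)"] by simp
      then show ?thesis using 2 by (simp add: hfield_def inner_prod_def inner_axis dx_eq[OF H])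
    qed
  qed
  then have "(\<Sum>b\<in>Basis. (hfield H X \<bullet> b) *\<^sub>R b) = (\<Sum>b\<in>Basis. ?D (- phase_J b) *\<^sub>R b)"
    by (intro sum.cong) auto
  then show "hfield H X = (\<Sum>b\<in>Basis. ?D (- phase_J b) *\<^sub>R b)"
    by (simp only: euclidean_representation)
qed

lemma hfield_derivatives:
  fixes H :: "'n::finite phase \<Rightarrow> real"
  assumes H: "smooth H"
  obtains V' V''
  where "\<And>X. (hfield H has_derivative blinfun_apply (V' X)) (at X)"
    and "\<And>X. (V' has_derivative blinfun_apply (V'' X)) (at X)"
    and "continuous_on UNIV V''"
    and "\<And>X u v. phase_J (V' X u) \<bullet> v = phase_J (V' X v) \<bullet> u"
proof -
  let ?DH = "\<lambda>v Y. frechet_derivative H (at Y) v"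
  obtain V' V'' where
    V: "\<And>X. ((\<lambda>X. \<Sum>b\<in>Basis. ?DH (- phase_J b) X *\<^sub>R b) has_derivative blinfun_apply (V' X)) (at X)"
    and V': "\<And>X. (V' has_derivative blinfun_apply (V'' X)) (at X)" "continuous_on UNIV V''"
    and V'_eq: "\<And>X u. V' X u = (\<Sum>b\<in>Basis. frechet_derivative (?DH (- phase_J b)) (at X) u *\<^sub>R b)"
    by (rule smooth_field_derivatives[of "\<lambda>b. ?DH (- phase_J b)"])
      (auto intro: smooth_frechet_derivative H)
  have lin: "linear (\<lambda>v. ?DH v Y)" for Y
    by (rule has_derivative_linear[OF smooth_has_derivative[OF H]])
  have J_lin: "linear (phase_J :: 'n phase \<Rightarrow> _)"
    by (rule linearI) (simp_all add: phase_J_def)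
  have second: "phase_J (V' X u) \<bullet> v = - frechet_derivative (?DH v) (at X) u" for X u v
  proof -
    have "phase_J (V' X u) \<bullet> v = - (V' X u \<bullet> phase_J v)"
      by (simp add: phase_J_def inner_prod_def)
    also have "V' X u \<bullet> phase_J v = (\<Sum>b\<in>Basis. (phase_J v \<bullet> b) * frechet_derivative (?DH (- phase_J b)) (at X) u)"
      by (simp add: V'_eq inner_sum_left inner_sum_right inner_commute[of _ "phase_J v"] mult.commute)
    also have "\<dots> = frechet_derivative (?DH v) (at X) u"
    proof -
      have "((\<lambda>Y. \<Sum>b\<in>Basis. (phase_J v \<bullet> b) * ?DH (- phase_J b) Y) has_derivative
        (\<lambda>u. \<Sum>b\<in>Basis. (phase_J v \<bullet> b) * frechet_derivative (?DH (- phase_J b)) (at X) u)) (at X)"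
        by (intro has_derivative_sum has_derivative_mult_right smooth_has_derivative
            smooth_frechet_derivative H)
      moreover have "(\<Sum>b\<in>Basis. (phase_J v \<bullet> b) * ?DH (- phase_J b) Y) = ?DH v Y" for Y
      proof -
        have "(\<Sum>b\<in>Basis. (phase_J v \<bullet> b) * ?DH (- phase_J b) Y)
            = ?DH (\<Sum>b\<in>Basis. (phase_J v \<bullet> b) *\<^sub>R (- phase_J b)) Y"
          by (simp add: linear_sum[OF lin] linear_scale[OF lin] del: scaleR_minus_right)
        also have "(\<Sum>b\<in>Basis. (phase_J v \<bullet> b) *\<^sub>R (- phase_J b)) = - phase_J (\<Sum>b\<in>Basis. (phase_J v \<bullet> b) *\<^sub>R b)"
          by (simp add: linear_sum[OF J_lin] linear_scale[OF J_lin] sum_negf)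
        also have "\<dots> = v" by (simp add: euclidean_representation phase_J_def)
        finally show ?thesis .
      qed
      ultimately have "(?DH v has_derivative
        (\<lambda>u. \<Sum>b\<in>Basis. (phase_J v \<bullet> b) * frechet_derivative (?DH (- phase_J b)) (at X) u)) (at X)" by simp
      from has_derivative_unique[OF this smooth_has_derivative[OF smooth_frechet_derivative[OF H]]]
      show ?thesis by (rule fun_cong)
    qed
    finally show ?thesis .
  qed
  show thesis
  proof (rule that[of V' V''])
    show "(hfield H has_derivative blinfun_apply (V' X)) (at X)" for X
      using V by (simp add: hfield_eq[OF H])
    show "phase_J (V' X u) \<bullet> v = phase_J (V' X v) \<bullet> u" for X u v
      unfolding second by (simp add: smooth_second_derivative_symmetric[OF H, of v X u])
  qed (use V' in auto)
qed

text \<open>For a differentiable function the Liouville operator is the derivative in direction \<open>(1, V)\<close>.\<close>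

lemma liouville_has_derivative:
  fixes u :: "real \<Rightarrow> 'n::finite phase \<Rightarrow> 'b::real_normed_vector"
  assumes D: "((\<lambda>(t, X). u t X) has_derivative D) (at (t, X) within {0..} \<times> UNIV)" and t: "0 \<le> t"
  shows "liouville H u t X = D (1, hfield H X)"
proof -
  have lin: "linear D" using D by (rule has_derivative_linear)
  have "((\<lambda>s. (\<lambda>(t, X). u t X) (s, X)) has_derivative (\<lambda>h. D (h, 0))) (at t within {0..})"
    by (rule has_derivative_in_compose[where f = "\<lambda>s. (s, X)"])
      (auto intro!: derivative_eq_intros has_derivative_subset[OF D])
  moreover have "(\<lambda>h. D (h, 0)) = (\<lambda>h. h *\<^sub>R D (1, 0))"
  proof
    show "D (h, 0) = h *\<^sub>R D (1, 0)" for h using linear_scale[OF lin, of h "(1, 0)"] by simp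
  qed
  ultimately have "((\<lambda>s. u s X) has_vector_derivative D (1, 0)) (at t within {0..})"
    by (simp only: has_vector_derivative_def split_conv)
  then have 1: "vector_derivative (\<lambda>s. u s X) (at t within {0..}) = D (1, 0)"
    using at_within_Ici_nontrivial[OF t] by (intro vector_derivative_within)
  have 2: "(u t has_derivative (\<lambda>h. D (0, h))) (at X)"
  proof -
    have "((\<lambda>Y. (\<lambda>(t, X). u t X) (t, Y)) has_derivative (\<lambda>h. D (0, h))) (at X)"
      by (rule has_derivative_in_compose[where f = "\<lambda>Y. (t, Y)"])
        (use t in \<open>auto intro!: derivative_eq_intros has_derivative_subset[OF D]\<close>)
    then show ?thesis by simp
  qed
  have "(1, hfield H X) = (1, 0) + ((\<Sum>i\<in>UNIV. dp i H X *\<^sub>R (0, axis i 1, 0))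
      - (\<Sum>i\<in>UNIV. dx i H X *\<^sub>R (0, 0, axis i 1)))"
    by (simp add: hfield_def prod_eq_iff fst_sum snd_sum vec_eq_iff axis_def if_distrib cong: if_cong)
  then have "D (1, hfield H X) = D ((1, 0) + ((\<Sum>i\<in>UNIV. dp i H X *\<^sub>R (0, axis i 1, 0))
      - (\<Sum>i\<in>UNIV. dx i H X *\<^sub>R (0, 0, axis i 1))))"
    by (rule arg_cong)
  also have "\<dots> = D (1, 0) + ((\<Sum>i\<in>UNIV. dp i H X *\<^sub>R D (0, axis i 1, 0))
      - (\<Sum>i\<in>UNIV. dx i H X *\<^sub>R D (0, 0, axis i 1)))"
    by (simp only: linear_add[OF lin] linear_diff[OF lin] linear_sum[OF lin] linear_scale[OF lin])
  finally show ?thesis unfolding liouville_def 1 dx_eq[OF 2] dp_eq[OF 2] by simp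
qed

lemma liouville_ray:
  fixes u :: "real \<Rightarrow> 'n::finite phase \<Rightarrow> 'b::real_normed_vector"
  assumes "C1_global u" and t: "0 \<le> t"
  shows "((\<lambda>s. u (t + s) (X + s *\<^sub>R hfield H X)) has_vector_derivative liouville H u t X)
    (at 0 within {0..})"
proof -
  obtain D where D: "((\<lambda>(t, X). u t X) has_derivative D) (at (t, X) within {0..} \<times> UNIV)"
    using assms unfolding C1_global_def C1_on_def by blast
  show ?thesis
    using has_vector_derivative_ray[OF D t, of 1 "hfield H X"] liouville_has_derivative[OF D t, of H]
    by simp
qed

lemma C1_global_has_derivative: "C1_global u \<Longrightarrow> 0 \<le> t \<Longrightarrow>
    \<exists>D. ((\<lambda>(t, X). u t X) has_derivative D) (at (t, X) within {0..} \<times> UNIV)"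
  unfolding C1_global_def C1_on_def by blast

lemma liouville_bounded_linear:
  fixes u :: "real \<Rightarrow> 'n::finite phase \<Rightarrow> 'b::real_normed_vector"
  assumes h: "bounded_linear h" and u: "C1_global u" and t: "0 \<le> t"
  shows "liouville H (\<lambda>t X. h (u t X)) t X = h (liouville H u t X)"
proof -
  obtain D where D: "((\<lambda>(t, X). u t X) has_derivative D) (at (t, X) within {0..} \<times> UNIV)"
    using C1_global_has_derivative[OF u t] by blast
  from bounded_linear.has_derivative[OF h D]
  have "((\<lambda>(t, X). h (u t X)) has_derivative (\<lambda>v. h (D v))) (at (t, X) within {0..} \<times> UNIV)"
    by (simp add: split_def)
  from liouville_has_derivative[OF this t] liouville_has_derivative[OF D t]
  show ?thesis by simp
qed

lemma C1_global_bounded_linear: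
  fixes u :: "real \<Rightarrow> 'n::finite phase \<Rightarrow> 'b::real_normed_vector"
  assumes "bounded_linear h" "C1_global u"
  shows "C1_global (\<lambda>t X. h (u t X))"
  using C1_on_bounded_linear[OF assms(1)] assms(2) by (simp add: C1_global_def split_def)

text \<open>All that is used later about the Jacobian \<open>G\<close> of the solution: it is \<open>C\<^sup>1\<close>, its transpose is
  symplectic, the Liouville operator acts on it through \<open>V'\<close>, and the curves
  \<open>\<lambda>t. \<phi> t X + X0\<close> are trajectories of \<open>- V\<close>.\<close>

lemma liouville_jacobian:
  fixes H :: "'n::finite phase \<Rightarrow> real" and \<phi> :: "real \<Rightarrow> 'n phase \<Rightarrow> 'n phase"
  assumes H: "smooth H" and \<phi>: "solves_liouville H \<phi>" and init: "\<And>X. \<phi> 0 X = X - X0"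
  obtains G :: "real \<Rightarrow> 'n phase \<Rightarrow> 'n phase \<Rightarrow>\<^sub>L 'n phase" and V' :: "'n phase \<Rightarrow> 'n phase \<Rightarrow>\<^sub>L 'n phase"
  where "\<And>t X. 0 \<le> t \<Longrightarrow> (\<phi> t has_derivative G t X) (at X)"
    and "\<And>t X u v. 0 \<le> t \<Longrightarrow> (\<Sum>b\<in>Basis. (G t X b \<bullet> u) * (G t X (phase_J b) \<bullet> v)) = phase_J u \<bullet> v"
    and "\<And>w e. C1_global (\<lambda>t X. G t X w \<bullet> e)"
    and "\<And>t X w e. 0 \<le> t \<Longrightarrow> liouville H (\<lambda>t X. G t X w \<bullet> e) t X = - (G t X (V' X w) \<bullet> e)"
    and "\<And>X. (hfield H has_derivative V' X) (at X)"
    and "\<And>t X. 0 \<le> t \<Longrightarrow>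
      ((\<lambda>t. \<phi> t X + X0) has_vector_derivative - hfield H (\<phi> t X + X0)) (at t within {0..})"
proof -
  obtain V' V'' where V:
    "\<And>X. (hfield H has_derivative blinfun_apply (V' X)) (at X)"
    "\<And>X. (V' has_derivative blinfun_apply (V'' X)) (at X)"
    "continuous_on UNIV V''"
    "\<And>X u v. phase_J (V' X u) \<bullet> v = phase_J (V' X v) \<bullet> u"
    using hfield_derivatives[OF H] by metis
  obtain F' where F': "\<forall>z\<in>{0..} \<times> UNIV. ((\<lambda>(t, X). \<phi> t X) has_derivative blinfun_apply (F' z))
      (at z within {0..} \<times> UNIV)" "continuous_on ({0..} \<times> UNIV) F'"
    using \<phi> unfolding solves_liouville_def C1_global_def C1_on_def by blast
  interpret hamiltonian_transport "hfield H" V' V'' "\<lambda>t X. \<phi> t X + X0" F' phase_J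
  proof
    fix t :: real and X :: "'n phase"
    assume t: "0 \<le> t"
    have D: "((\<lambda>(t, X). \<phi> t X) has_derivative blinfun_apply (F' (t, X))) (at (t, X) within {0..} \<times> UNIV)"
      using bspec[OF F'(1), of "(t, X)"] t by simp
    from has_derivative_add[OF this has_derivative_const[of X0]]
    show "((\<lambda>(t, X). \<phi> t X + X0) has_derivative blinfun_apply (F' (t, X))) (at (t, X) within {0..} \<times> UNIV)"
      by (simp add: split_def)
    show "F' (t, X) (1, hfield H X) = 0"
      using liouville_has_derivative[OF D t, of H] \<phi> t unfolding solves_liouville_def by metis
  qed (use V F' init linear_phase_J in \<open>auto simp: phase_J_def inner_prod_def\<close>)
  show thesis
  proof (rule that[of G V'])
    fix t :: real and X :: "'n phase" assume t: "0 \<le> t"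
    from has_derivative_diff[OF F_deriv_space[OF t, of X] has_derivative_const[of X0]]
    show "(\<phi> t has_derivative G t X) (at X)" by simp
    show "((\<lambda>t. \<phi> t X + X0) has_vector_derivative - hfield H (\<phi> t X + X0)) (at t within {0..})"
      using F_time[OF t] .
    show "(\<Sum>b\<in>Basis. (G t X b \<bullet> u) * (G t X (phase_J b) \<bullet> v)) = phase_J u \<bullet> v" for u v
      by (rule dual_symplectic[OF t])
    fix w e
    have D: "((\<lambda>(t, X). G t X w \<bullet> e) has_derivative
      (\<lambda>(h, v). h * (- V' (\<phi> t X + X0) (G t X w) \<bullet> e) + G_space_deriv t X w e v)) (at (t, X) within {0..} \<times> UNIV)"
      by (rule G_has_derivative[OF t])
    show "liouville H (\<lambda>t X. G t X w \<bullet> e) t X = - (G t X (V' X w) \<bullet> e)"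
      unfolding liouville_has_derivative[OF D t] by (rule G_transport[OF t D])
  next
    show "C1_global (\<lambda>t X. G t X w \<bullet> e)" for w e
      using G_C1 by (simp add: C1_global_def)
  qed (rule V)
qed

section \<open>Products of complex matrices\<close>

lemma bounded_bilinear_matrix_mult:
  "bounded_bilinear ((**) :: complex ^ 'n ^ 'n \<Rightarrow> complex ^ 'n ^ 'n \<Rightarrow> complex ^ 'n ^ 'n)"
proof -
  have "A ** (r *\<^sub>R B) = r *\<^sub>R (A ** B)" "(r *\<^sub>R A) ** B = r *\<^sub>R (A ** B)"
    for r and A B :: "complex ^ 'n ^ 'n"
    by (simp_all add: matrix_matrix_mult_def vec_eq_iff scaleR_sum_right)
  then have "bilinear ((**) :: complex ^ 'n ^ 'n \<Rightarrow> complex ^ 'n ^ 'n \<Rightarrow> complex ^ 'n ^ 'n)"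
    unfolding bilinear_def
    by (auto intro!: linearI simp: matrix_add_ldistrib matrix_matrix_mult_def vec_eq_iff
        distrib_right distrib_left sum.distrib scaleR_sum_right)
  then show ?thesis by (simp add: bilinear_conv_bounded_bilinear)
qed

interpretation matrix_mult: bounded_bilinear
  "(**) :: complex ^ 'n ^ 'n \<Rightarrow> complex ^ 'n ^ 'n \<Rightarrow> complex ^ 'n ^ 'n"
  by (rule bounded_bilinear_matrix_mult)

lemma has_vector_derivative_matrix:
  fixes A :: "real \<Rightarrow> complex ^ 'n ^ 'm"
  assumes "\<And>i j. ((\<lambda>s. A s $ i $ j) has_vector_derivative D $ i $ j) (at s within S)"
  shows "(A has_vector_derivative D) (at s within S)"
  unfolding has_vector_derivative_def
proof (subst has_derivative_componentwise_within, intro ballI)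
  fix b :: "complex ^ 'n ^ 'm" assume "b \<in> Basis"
  then obtain i j c where b: "b = axis i (axis j c)" by (auto simp: Basis_vec_def)
  show "((\<lambda>x. A x \<bullet> b) has_derivative (\<lambda>x. (x *\<^sub>R D) \<bullet> b)) (at s within S)"
    using has_derivative_inner_left[OF assms[of i j, unfolded has_vector_derivative_def], of c]
    by (simp add: b inner_axis)
qed

lemma riccati_algebra:
  fixes P Q N L :: "complex ^ 'n ^ 'n"
  assumes "N ** (A ** P - B ** Q) + L ** P = - (C ** P - D ** Q)" and "N ** P = - Q"
  shows "(L + C + D ** N + N ** A + N ** B ** N) ** P = 0"
proof -
  have Q: "Q = - (N ** P)" using assms(2) by simp
  show ?thesis using assms(1) unfolding Q
    by (simp add: matrix_mult.add_left matrix_mult.add_right matrix_mult.minus_right matrix_mult.diff_right matrix_mul_assoc algebra_simps)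
qed

lemma riccati_difference:
  fixes M N :: "complex ^ 'n ^ 'n"
  assumes "L + C + D ** M + M ** A + M ** B ** M = 0" and "L' + C + D ** N + N ** A + N ** B ** N = 0"
  shows "L - L' = - (D ** (M - N) + (M - N) ** A + (M ** B) ** (M - N) + (M - N) ** (B ** N))"
proof -
  have "L = - (C + D ** M + M ** A + M ** B ** M)" "L' = - (C + D ** N + N ** A + N ** B ** N)"
    using assms by (simp_all only: eq_neg_iff_add_eq_0 add.assoc)
  then show ?thesis by (simp add: matrix_mult.diff_left matrix_mult.diff_right matrix_mul_assoc)
qed

section \<open>The complex Jacobians and the Riccati equation\<close>

text \<open>The solution \<open>\<phi>\<close> with the properties of its Jacobian \<open>G\<close>, and the weights \<open>k1\<close>, \<open>k2\<close>.
  The abbreviations \<open>P\<close> and \<open>Q\<close> stand for \<open>g\<^sub>p\<close> and \<open>g\<^sub>x\<close>, and \<open>N\<close> for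
  \<open>- Q P\<^sup>-\<^sup>1\<close>.\<close>

locale liouville_solution =
  fixes H :: "'n::finite phase \<Rightarrow> real"
    and X0 :: "'n phase"
    and \<phi> :: "real \<Rightarrow> 'n phase \<Rightarrow> 'n phase"
    and G :: "real \<Rightarrow> 'n phase \<Rightarrow> 'n phase \<Rightarrow>\<^sub>L 'n phase"
    and V' :: "'n phase \<Rightarrow> 'n phase \<Rightarrow>\<^sub>L 'n phase"
    and k1 k2 :: complex
  assumes smooth_H: "smooth H"
    and \<phi>_solves: "solves_liouville H \<phi>"
    and \<phi>_init: "\<And>X. \<phi> 0 X = X - X0"
    and \<phi>_deriv: "\<And>t X. 0 \<le> t \<Longrightarrow> (\<phi> t has_derivative G t X) (at X)"
    and dual_symplectic: "\<And>t X u v. 0 \<le> t \<Longrightarrow>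
      (\<Sum>b\<in>Basis. (G t X b \<bullet> u) * (G t X (phase_J b) \<bullet> v)) = phase_J u \<bullet> v"
    and G_C1: "\<And>w e. C1_global (\<lambda>t X. G t X w \<bullet> e)"
    and G_liouville: "\<And>t X w e. 0 \<le> t \<Longrightarrow>
      liouville H (\<lambda>t X. G t X w \<bullet> e) t X = - (G t X (V' X w) \<bullet> e)"
    and V'_deriv: "\<And>X. (hfield H has_derivative V' X) (at X)"
    and flow: "\<And>t X. 0 \<le> t \<Longrightarrow>
      ((\<lambda>t. \<phi> t X + X0) has_vector_derivative - hfield H (\<phi> t X + X0)) (at t within {0..})"
begin

abbreviation "g \<equiv> comb k1 k2 \<phi>"
abbreviation "P t X \<equiv> grad_p (g t) X"
abbreviation "Q t X \<equiv> grad_x (g t) X"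
abbreviation "N t X \<equiv> - (Q t X ** matrix_inv (P t X))"

text \<open>The derivative in direction \<open>w\<close> of \<open>c1 \<phi>\<^sub>1 + c2 \<phi>\<^sub>2\<close>. The rows of \<open>P\<close> and \<open>Q\<close> are of this
  form with \<open>w\<close> a coordinate vector; other weights are admitted for the complex conjugates.\<close>

definition jac_row :: "complex \<Rightarrow> complex \<Rightarrow> real \<Rightarrow> 'n phase \<Rightarrow> 'n phase \<Rightarrow> complex ^ 'n" where
  "jac_row c1 c2 t X w = (\<chi> j. c1 * of_real (G t X w \<bullet> (axis j 1, 0)) + c2 * of_real (G t X w \<bullet> (0, axis j 1)))"

lemma jac_row_nth: "jac_row c1 c2 t X w $ j =
    c1 * of_real (fst (G t X w) $ j) + c2 * of_real (snd (G t X w) $ j)"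
  by (simp add: jac_row_def inner_prod_def inner_axis)

lemma linear_jac_row: "linear (jac_row c1 c2 t X)"
  by (rule linearI) (simp_all add: vec_eq_iff jac_row_nth blinfun.add_right blinfun.scaleR_right
      algebra_simps scaleR_conv_of_real[where 'a = complex])

lemma g_deriv:
  assumes "0 \<le> t"
  shows "((\<lambda>X. g t X $ j) has_derivative (\<lambda>w. jac_row k1 k2 t X w $ j)) (at X)"
proof -
  have "((\<lambda>X. fst (\<phi> t X) $ j) has_derivative (\<lambda>w. fst (G t X w) $ j)) (at X)"
    "((\<lambda>X. snd (\<phi> t X) $ j) has_derivative (\<lambda>w. snd (G t X w) $ j)) (at X)"
    using \<phi>_deriv[OF assms, of X]
    by (auto intro!: bounded_linear.has_derivative[OF bounded_linear_vec_nth] has_derivative_fst has_derivative_snd)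
  then show ?thesis
    unfolding comb_def jac_row_nth vec_lambda_beta
    by (intro has_derivative_add has_derivative_mult_right has_derivative_of_real)
qed

lemma Q_nth: "0 \<le> t \<Longrightarrow> Q t X $ i $ j = jac_row k1 k2 t X (axis i 1, 0) $ j"
  by (simp add: grad_x_def dx_eq[OF g_deriv])

lemma P_nth: "0 \<le> t \<Longrightarrow> P t X $ i $ j = jac_row k1 k2 t X (0, axis i 1) $ j"
  by (simp add: grad_p_def dp_eq[OF g_deriv])

lemma jac_row_C1: "C1_on ({0..} \<times> UNIV) (\<lambda>z. jac_row c1 c2 (fst z) (snd z) w $ j)"
  unfolding jac_row_def vec_lambda_beta
  using G_C1[unfolded C1_global_def split_def]
  by (intro C1_on_add C1_on_bilinear[OF bounded_bilinear_mult] C1_on_const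
      C1_on_bounded_linear[OF bounded_linear_of_real])

lemma jac_row_ray:
  assumes t: "0 \<le> t"
  shows "((\<lambda>s. jac_row c1 c2 (t + s) (X + s *\<^sub>R hfield H X) w $ j) has_vector_derivative
    - jac_row c1 c2 t X (V' X w) $ j) (at 0 within {0..})"
proof -
  have "((\<lambda>s. c * of_real (G (t + s) (X + s *\<^sub>R hfield H X) w \<bullet> e)) has_vector_derivative
      c * of_real (- (G t X (V' X w) \<bullet> e))) (at 0 within {0..})" for c :: complex and e
    using liouville_ray[OF G_C1[of w e] t, of X H] unfolding G_liouville[OF t]
    by (intro has_vector_derivative_mult_right
        bounded_linear.has_vector_derivative[OF bounded_linear_of_real])
  from has_vector_derivative_add[OF this[of c1 "(axis j 1, 0)"] this[of c2 "(0, axis j 1)"]]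
  show ?thesis by (simp add: jac_row_def)
qed

lemma phase_expansion:
  "Y = (\<Sum>l\<in>UNIV. fst Y $ l *\<^sub>R (axis l 1, 0)) + (\<Sum>l\<in>UNIV. snd Y $ l *\<^sub>R (0, axis l 1))"
  for Y :: "'n phase"
  by (simp add: prod_eq_iff fst_sum snd_sum vec_eq_iff axis_def if_distrib cong: if_cong)

lemma V'_nth:
  "fst (V' X (axis i 1, 0)) $ l = dx i (dp l H) X" "snd (V' X (axis i 1, 0)) $ l = - dx i (dx l H) X"
  "fst (V' X (0, axis i 1)) $ l = dp i (dp l H) X" "snd (V' X (0, axis i 1)) $ l = - dp i (dx l H) X"
proof -
  have "((\<lambda>X. fst (hfield H X) $ l) has_derivative (\<lambda>u. fst (V' X u) $ l)) (at X)"
    "((\<lambda>X. - (snd (hfield H X) $ l)) has_derivative (\<lambda>u. - (snd (V' X u) $ l))) (at X)"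
    using V'_deriv[of X]
    by (auto intro!: bounded_linear.has_derivative[OF bounded_linear_vec_nth] has_derivative_fst
        has_derivative_snd has_derivative_minus)
  then have "(dp l H has_derivative (\<lambda>u. fst (V' X u) $ l)) (at X)"
    "(dx l H has_derivative (\<lambda>u. - (snd (V' X u) $ l))) (at X)"
    by (simp_all add: hfield_def)
  from dx_eq[OF this(1), of i] dx_eq[OF this(2), of i] dp_eq[OF this(1), of i] dp_eq[OF this(2), of i]
  show "fst (V' X (axis i 1, 0)) $ l = dx i (dp l H) X" "snd (V' X (axis i 1, 0)) $ l = - dx i (dx l H) X"
    "fst (V' X (0, axis i 1)) $ l = dp i (dp l H) X" "snd (V' X (0, axis i 1)) $ l = - dp i (dx l H) X"
    by simp_all
qed

lemma dp_dx_commute: "dp i (dx l H) X = dx l (dp i H) X"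
  by (simp add: dx_smooth dp_smooth smooth_frechet_derivative smooth_H
      smooth_second_derivative_symmetric[OF smooth_H, of "(axis l 1, 0)"])

lemma jac_row_expansion:
  "jac_row c1 c2 t X Y = (\<Sum>l\<in>UNIV. fst Y $ l *\<^sub>R jac_row c1 c2 t X (axis l 1, 0))
    + (\<Sum>l\<in>UNIV. snd Y $ l *\<^sub>R jac_row c1 c2 t X (0, axis l 1))"
  by (subst phase_expansion[of Y])
    (simp only: linear_add[OF linear_jac_row] linear_sum[OF linear_jac_row] linear_scale[OF linear_jac_row])

text \<open>Here and in \<open>P_ray\<close>: the Liouville operator applied to \<open>Q\<close> and \<open>P\<close>, by expanding
  \<open>V'\<close> of a coordinate vector in second derivatives of \<open>H\<close>.\<close>

lemma Q_ray:
  assumes t: "0 \<le> t"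
  shows "((\<lambda>s. Q (t + s) (X + s *\<^sub>R hfield H X)) has_vector_derivative
    Hxx H X ** P t X - Hxp H X ** Q t X) (at 0 within {0..})"
proof (rule has_vector_derivative_matrix, rule has_vector_derivative_transform)
  fix i j
  have "- jac_row k1 k2 t X (V' X (axis i 1, 0)) $ j = (Hxx H X ** P t X - Hxp H X ** Q t X) $ i $ j"
    using t by (simp add: jac_row_expansion[of _ _ _ _ "V' X _"] V'_nth matrix_matrix_mult_def Hxx_def Hxp_def
        Q_nth P_nth scaleR_conv_of_real[where 'a = complex] sum_negf)
  then show "((\<lambda>s. jac_row k1 k2 (t + s) (X + s *\<^sub>R hfield H X) (axis i 1, 0) $ j) has_vector_derivative
      (Hxx H X ** P t X - Hxp H X ** Q t X) $ i $ j) (at 0 within {0..})"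
    using jac_row_ray[OF t, of k1 k2 X "(axis i 1, 0)" j] by (simp only:)
qed (use t Q_nth in auto)

lemma P_ray:
  assumes t: "0 \<le> t"
  shows "((\<lambda>s. P (t + s) (X + s *\<^sub>R hfield H X)) has_vector_derivative
    Hpx H X ** P t X - Hpp H X ** Q t X) (at 0 within {0..})"
proof (rule has_vector_derivative_matrix, rule has_vector_derivative_transform)
  fix i j
  have "- jac_row k1 k2 t X (V' X (0, axis i 1)) $ j = (Hpx H X ** P t X - Hpp H X ** Q t X) $ i $ j"
    using t by (simp add: jac_row_expansion[of _ _ _ _ "V' X _"] V'_nth matrix_matrix_mult_def Hpx_def Hxp_def
        Hpp_def transpose_def Q_nth P_nth scaleR_conv_of_real[where 'a = complex] sum_negf dp_dx_commute)
  then show "((\<lambda>s. jac_row k1 k2 (t + s) (X + s *\<^sub>R hfield H X) (0, axis i 1) $ j) has_vector_derivative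
      (Hpx H X ** P t X - Hpp H X ** Q t X) $ i $ j) (at 0 within {0..})"
    using jac_row_ray[OF t, of k1 k2 X "(0, axis i 1)" j] by (simp only:)
qed (use t P_nth in auto)

lemma jacobian_bracket:
  assumes t: "0 \<le> t"
  shows "(\<Sum>i\<in>UNIV. (G t X (0, axis i 1) \<bullet> u) * (G t X (axis i 1, 0) \<bullet> v)
    - (G t X (axis i 1, 0) \<bullet> u) * (G t X (0, axis i 1) \<bullet> v)) = phase_J u \<bullet> v"
proof -
  have "G t X (0, - axis i 1) = - G t X (0, axis i 1)" for i
    using blinfun.minus_right[of "G t X" "(0, axis i 1)"] by simp
  then show ?thesis
    using dual_symplectic[OF t, of X u v] by (simp add: sum_Basis_phase phase_J_def sum_subtractf sum_negf)
qed

text \<open>The bracket of the \<open>j\<close>-th and \<open>l\<close>-th components of two combinations of \<open>\<phi>\<^sub>1\<close> and \<open>\<phi>\<^sub>2\<close>: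
  equal weights give the symmetry of \<open>P\<^sup>T Q\<close>, conjugate weights the Hermitian identity.\<close>

lemma jac_row_bracket:
  assumes t: "0 \<le> t"
  shows "(\<Sum>i\<in>UNIV. jac_row c1 c2 t X (0, axis i 1) $ j * jac_row d1 d2 t X (axis i 1, 0) $ l
    - jac_row c1 c2 t X (axis i 1, 0) $ j * jac_row d1 d2 t X (0, axis i 1) $ l)
    = (if j = l then c2 * d1 - c1 * d2 else 0)"
proof -
  define B where "B = (\<lambda>i u v. (G t X (0, axis i 1) \<bullet> u) * (G t X (axis i 1, 0) \<bullet> v)
    - (G t X (axis i 1, 0) \<bullet> u) * (G t X (0, axis i 1) \<bullet> v))"
  let ?x = "\<lambda>j. (axis j 1, 0) :: 'n phase" and ?p = "\<lambda>j. (0, axis j 1) :: 'n phase"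
  have B: "(\<Sum>i\<in>UNIV. B i u v) = phase_J u \<bullet> v" for u v
    unfolding B_def by (rule jacobian_bracket[OF t])
  have "jac_row c1 c2 t X (?p i) $ j * jac_row d1 d2 t X (?x i) $ l - jac_row c1 c2 t X (?x i) $ j * jac_row d1 d2 t X (?p i) $ l
    = c1 * d1 * of_real (B i (?x j) (?x l)) + c1 * d2 * of_real (B i (?x j) (?p l))
    + c2 * d1 * of_real (B i (?p j) (?x l)) + c2 * d2 * of_real (B i (?p j) (?p l))" for i
    by (simp add: jac_row_def B_def algebra_simps)
  then have "(\<Sum>i\<in>UNIV. jac_row c1 c2 t X (?p i) $ j * jac_row d1 d2 t X (?x i) $ l
      - jac_row c1 c2 t X (?x i) $ j * jac_row d1 d2 t X (?p i) $ l)
    = c1 * d1 * of_real (phase_J (?x j) \<bullet> ?x l) + c1 * d2 * of_real (phase_J (?x j) \<bullet> ?p l)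
    + c2 * d1 * of_real (phase_J (?p j) \<bullet> ?x l) + c2 * d2 * of_real (phase_J (?p j) \<bullet> ?p l)"
    by (simp add: sum.distrib sum_distrib_left[symmetric] of_real_sum[symmetric] B del: of_real_sum)
  also have "\<dots> = (if j = l then c2 * d1 - c1 * d2 else 0)"
    by (simp add: phase_J_def inner_prod_def inner_axis_axis)
  finally show ?thesis .
qed

lemma cnj_jac_row: "cnj (jac_row c1 c2 t X w $ j) = jac_row (cnj c1) (cnj c2) t X w $ j"
  by (simp add: jac_row_def)

lemma PQ_symmetric:
  assumes t: "0 \<le> t"
  shows "transpose (P t X) ** Q t X = transpose (Q t X) ** P t X"
proof -
  have "(\<Sum>i\<in>UNIV. P t X $ i $ j * Q t X $ i $ l - Q t X $ i $ j * P t X $ i $ l) = 0" for j l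
    using jac_row_bracket[OF t, of k1 k2 X j k1 k2 l] t by (simp add: P_nth Q_nth)
  then show ?thesis
    by (simp add: vec_eq_iff matrix_matrix_mult_def transpose_def sum_subtractf)
qed

lemma PQ_hermitian:
  assumes t: "0 \<le> t"
  shows "(\<Sum>i\<in>UNIV. cnj ((P t X *v v) $ i) * (Q t X *v v) $ i - cnj ((Q t X *v v) $ i) * (P t X *v v) $ i)
    = (cnj k2 * k1 - cnj k1 * k2) * of_real (\<Sum>j\<in>UNIV. (norm (v $ j))\<^sup>2)"
proof -
  let ?B = "\<lambda>i j l. cnj (P t X $ i $ j) * Q t X $ i $ l - cnj (Q t X $ i $ j) * P t X $ i $ l"
  have B: "(\<Sum>i\<in>UNIV. ?B i j l) = (if j = l then cnj k2 * k1 - cnj k1 * k2 else 0)" for j l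
    using jac_row_bracket[OF t, of "cnj k1" "cnj k2" X j k1 k2 l] t by (simp add: P_nth Q_nth cnj_jac_row)
  have expand: "cnj ((A *v v) $ i) * (C *v v) $ i
    = (\<Sum>j\<in>UNIV. \<Sum>l\<in>UNIV. cnj (v $ j) * v $ l * (cnj (A $ i $ j) * C $ i $ l))"
    for A C :: "complex ^ 'n ^ 'n" and i
    by (simp add: matrix_vector_mult_def sum_product) (intro sum.cong refl, simp)
  have "cnj ((P t X *v v) $ i) * (Q t X *v v) $ i - cnj ((Q t X *v v) $ i) * (P t X *v v) $ i
    = (\<Sum>j\<in>UNIV. \<Sum>l\<in>UNIV. cnj (v $ j) * v $ l * ?B i j l)" for i
    by (simp only: expand right_diff_distrib sum_subtractf)
  then have "(\<Sum>i\<in>UNIV. cnj ((P t X *v v) $ i) * (Q t X *v v) $ i - cnj ((Q t X *v v) $ i) * (P t X *v v) $ i)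
    = (\<Sum>i\<in>UNIV. \<Sum>j\<in>UNIV. \<Sum>l\<in>UNIV. cnj (v $ j) * v $ l * ?B i j l)" by simp
  also have "\<dots> = (\<Sum>j\<in>UNIV. \<Sum>i\<in>UNIV. \<Sum>l\<in>UNIV. cnj (v $ j) * v $ l * ?B i j l)"
    by (rule sum.swap)
  also have "\<dots> = (\<Sum>j\<in>UNIV. \<Sum>l\<in>UNIV. \<Sum>i\<in>UNIV. cnj (v $ j) * v $ l * ?B i j l)"
    by (rule sum.cong[OF refl]) (rule sum.swap)
  also have "\<dots> = (\<Sum>j\<in>UNIV. \<Sum>l\<in>UNIV. cnj (v $ j) * v $ l * (if j = l then cnj k2 * k1 - cnj k1 * k2 else 0))"
    by (simp only: sum_distrib_left[symmetric] B)
  also have "\<dots> = (\<Sum>j\<in>UNIV. cnj (v $ j) * v $ j * (cnj k2 * k1 - cnj k1 * k2))"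
    by (simp add: if_distrib cong: if_cong)
  also have "\<dots> = (cnj k2 * k1 - cnj k1 * k2) * of_real (\<Sum>j\<in>UNIV. (norm (v $ j))\<^sup>2)"
  proof -
    have "cnj z * z = of_real ((norm z)\<^sup>2)" for z :: complex
      by (simp only: complex_norm_square mult.commute)
    then show ?thesis by (simp only: of_real_sum sum_distrib_left mult.commute)
  qed
  finally show ?thesis .
qed

lemma sum_norm_pos: "v \<noteq> 0 \<Longrightarrow> 0 < (\<Sum>j\<in>UNIV. (norm (v $ j))\<^sup>2)" for v :: "complex ^ 'n"
proof -
  assume "v \<noteq> 0"
  then obtain j where "v $ j \<noteq> 0" by (auto simp: vec_eq_iff)
  then show ?thesis by (intro sum_pos2[of _ j]) auto
qed

lemma P_invertible:
  assumes t: "0 \<le> t" and k: "Im (cnj k1 * k2) \<noteq> 0"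
  shows "invertible (P t X)"
proof -
  have "v = 0" if "P t X *v v = 0" for v
  proof (rule ccontr)
    assume "v \<noteq> 0"
    have "cnj k2 * k1 - cnj k1 * k2 \<noteq> 0" using k by (auto simp: complex_eq_iff)
    moreover have "(cnj k2 * k1 - cnj k1 * k2) * of_real (\<Sum>j\<in>UNIV. (norm (v $ j))\<^sup>2) = 0"
      using PQ_hermitian[OF t, of X v] that by simp
    ultimately show False using sum_norm_pos[OF \<open>v \<noteq> 0\<close>]
      by (simp del: of_real_sum)
  qed
  then show ?thesis by (simp add: invertible_left_inverse matrix_left_invertible_ker)
qed

lemma g_solves: "solves_liouville H g"
proof -
  define h where "h = (\<lambda>Y :: 'n phase. (\<chi> j. k1 * of_real (fst Y $ j) + k2 * of_real (snd Y $ j)) :: complex ^ 'n)"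
  have "linear h"
    by (rule linearI) (simp_all add: h_def vec_eq_iff algebra_simps scaleR_conv_of_real[where 'a = complex])
  then have h: "bounded_linear h" by (simp add: linear_conv_bounded_linear)
  have g: "g = (\<lambda>t X. h (\<phi> t X))" by (simp add: fun_eq_iff comb_def h_def)
  have "h 0 = 0" using \<open>linear h\<close> by (rule linear_0)
  have C1: "C1_global \<phi>" and L: "\<And>t X. 0 \<le> t \<Longrightarrow> liouville H \<phi> t X = 0"
    using \<phi>_solves unfolding solves_liouville_def by blast+
  show ?thesis
    unfolding g solves_liouville_def
    by (auto simp: liouville_bounded_linear[OF h C1] L \<open>h 0 = 0\<close> intro: C1_global_bounded_linear[OF h C1])
qed

context
  assumes k: "Im (cnj k1 * k2) \<noteq> 0"
begin

lemma N_P: "0 \<le> t \<Longrightarrow> N t X ** P t X = - Q t X"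
  using matrix_inv_inverse(2)[OF P_invertible[OF _ k]]
  by (simp add: matrix_mult.minus_left matrix_mul_assoc[symmetric])

lemma N_C1: "C1_global N"
  unfolding C1_global_def
proof (intro C1_on_vec)
  fix i j
  have Q: "C1_on ({0..} \<times> UNIV) (\<lambda>z. Q (fst z) (snd z) $ i $ j)" for i j
    by (rule C1_on_cong[OF jac_row_C1]) (auto simp: Q_nth)
  have P: "C1_on ({0..} \<times> UNIV) (\<lambda>z. P (fst z) (snd z) $ i $ j)" for i j
    by (rule C1_on_cong[OF jac_row_C1]) (auto simp: P_nth)
  have "C1_on ({0..} \<times> UNIV) (\<lambda>z. - (\<Sum>l\<in>UNIV. Q (fst z) (snd z) $ i $ l * matrix_inv (P (fst z) (snd z)) $ l $ j))"
    by (intro C1_on_bounded_linear[OF bounded_linear_minus[OF bounded_linear_ident]] C1_on_sum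
        C1_on_bilinear[OF bounded_bilinear_mult] C1_on_matrix_inv Q P P_invertible k) auto
  then show "C1_on ({0..} \<times> UNIV) (\<lambda>z. (case z of (t, X) \<Rightarrow> N t X) $ i $ j)"
    by (simp add: split_def matrix_matrix_mult_def)
qed

text \<open>Both sides of \<open>N P = - Q\<close> are differentiated along the Liouville direction, and \<open>P\<close> is
  cancelled.\<close>

lemma N_riccati:
  assumes t: "0 \<le> t"
  shows "liouville H N t X + Hxx H X + Hxp H X ** N t X + N t X ** Hpx H X
    + N t X ** Hpp H X ** N t X = 0"
proof -
  let ?N = "N t X" and ?P = "P t X" and ?Q = "Q t X" and ?L = "liouville H N t X"
  have "((\<lambda>s. N (t + s) (X + s *\<^sub>R hfield H X) ** P (t + s) (X + s *\<^sub>R hfield H X)) has_vector_derivative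
      ?N ** (Hpx H X ** ?P - Hpp H X ** ?Q) + ?L ** ?P) (at 0 within {0..})"
    using matrix_mult.has_vector_derivative[OF liouville_ray[OF N_C1 t] P_ray[OF t]] by simp
  moreover have "((\<lambda>s. N (t + s) (X + s *\<^sub>R hfield H X) ** P (t + s) (X + s *\<^sub>R hfield H X)) has_vector_derivative
      - (Hxx H X ** ?P - Hxp H X ** ?Q)) (at 0 within {0..})"
    by (rule has_vector_derivative_transform[OF _ _ has_vector_derivative_minus[OF Q_ray[OF t]]])
      (use t N_P in auto)
  ultimately have "?N ** (Hpx H X ** ?P - Hpp H X ** ?Q) + ?L ** ?P = - (Hxx H X ** ?P - Hxp H X ** ?Q)"
    by (rule vector_derivative_unique_within[OF at_within_Ici_nontrivial[OF order_refl]])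
  then have "(?L + Hxx H X + Hxp H X ** ?N + ?N ** Hpx H X + ?N ** Hpp H X ** ?N) ** ?P = 0"
    by (rule riccati_algebra) (rule N_P[OF t])
  then have "(?L + Hxx H X + Hxp H X ** ?N + ?N ** Hpx H X + ?N ** Hpp H X ** ?N) ** ?P ** matrix_inv ?P = 0"
    by (simp add: matrix_mult.zero_left)
  then show ?thesis
    by (simp only: matrix_mul_assoc[symmetric] matrix_inv_inverse(1)[OF P_invertible[OF t k]] matrix_mul_rid)
qed

lemma N_solves: "solves_riccati H (N 0) N"
  unfolding solves_riccati_def using N_C1 N_riccati by auto

lemma N_symmetric:
  assumes t: "0 \<le> t"
  shows "transpose (N t X) = N t X"
proof -
  let ?P = "P t X" and ?Q = "Q t X" and ?B = "matrix_inv (P t X)"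
  have PB: "?P ** ?B = mat 1" by (rule matrix_inv_inverse[OF P_invertible[OF t k]])
  have "transpose (?Q ** ?B) = transpose ?B ** transpose ?Q ** (?P ** ?B)"
    by (simp add: matrix_transpose_mul PB)
  also have "\<dots> = transpose ?B ** (transpose ?Q ** ?P) ** ?B"
    by (simp only: matrix_mul_assoc)
  also have "\<dots> = transpose ?B ** (transpose ?P ** ?Q) ** ?B"
    by (simp only: PQ_symmetric[OF t])
  also have "\<dots> = transpose (?P ** ?B) ** (?Q ** ?B)"
    by (simp only: matrix_mul_assoc matrix_transpose_mul)
  also have "\<dots> = ?Q ** ?B" by (simp add: PB transpose_mat)
  finally have "transpose (?Q ** ?B) = ?Q ** ?B" .
  then show ?thesis by (simp add: transpose_def vec_eq_iff)
qed

lemma N_pos: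
  assumes t: "0 \<le> t" and neg: "Im (k1 / k2) < 0"
  shows "positive_definite (Im_matrix (N t X))"
  unfolding positive_definite_def
proof (intro conjI allI impI)
  show "transpose (Im_matrix (N t X)) = Im_matrix (N t X)"
    using N_symmetric[OF t, of X] by (simp add: Im_matrix_def transpose_def vec_eq_iff)
  fix w :: "real ^ 'n" assume w: "w \<noteq> 0"
  \<comment> \<open>With \<open>P v = w\<close> one has \<open>N w = - Q v\<close>, and \<open>w\<close> is real, so that the quadratic form is minus
    the imaginary part of the Hermitian pairing of \<open>P v\<close> with \<open>Q v\<close>.\<close>
  define w' :: "complex ^ 'n" where "w' = (\<chi> i. of_real (w $ i))"
  define v where "v = matrix_inv (P t X) *v w'"
  have Pv: "P t X *v v = w'"
    by (simp add: v_def matrix_vector_mul_assoc matrix_inv_inverse(1)[OF P_invertible[OF t k]])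
  have Nw: "N t X *v w' = - (Q t X *v v)"
  proof -
    have "N t X *v w' = - ((Q t X ** matrix_inv (P t X)) *v w')"
      by (simp add: matrix_vector_mult_def vec_eq_iff sum_negf)
    then show ?thesis by (simp add: v_def matrix_vector_mul_assoc)
  qed
  have "w' \<noteq> 0" using w by (auto simp: w'_def vec_eq_iff)
  then have v: "v \<noteq> 0" using Pv by auto
  define S where "S = (\<Sum>i\<in>UNIV. cnj ((P t X *v v) $ i) * (Q t X *v v) $ i)"
  have "S - cnj S = (cnj k2 * k1 - cnj k1 * k2) * of_real (\<Sum>j\<in>UNIV. (norm (v $ j))\<^sup>2)"
    using PQ_hermitian[OF t, of X v] by (simp add: S_def sum_subtractf mult.commute)
  then have "Im (S - cnj S) = Im ((cnj k2 * k1 - cnj k1 * k2) * of_real (\<Sum>j\<in>UNIV. (norm (v $ j))\<^sup>2))"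
    by (rule arg_cong)
  then have ImS: "Im S = Im (k1 * cnj k2) * (\<Sum>j\<in>UNIV. (norm (v $ j))\<^sup>2)"
    by (simp add: algebra_simps del: of_real_sum)
  have "Im (k1 * cnj k2) < 0"
  proof -
    have "k2 \<noteq> 0" using k by auto
    have "k1 / k2 = k1 * cnj k2 / of_real ((norm k2)\<^sup>2)"
      by (rule complex_div_cnj[unfolded of_real_power[symmetric]])
    then have "Im (k1 / k2) = Im (k1 * cnj k2) / (norm k2)\<^sup>2" by (simp only: Im_divide_of_real)
    with neg have "Im (k1 * cnj k2) / (norm k2)\<^sup>2 < 0" by (simp only:)
    then show ?thesis using \<open>k2 \<noteq> 0\<close> by (simp only: divide_less_0_iff) simp
  qed
  then have "Im S < 0" unfolding ImS using sum_norm_pos[OF v] by (rule mult_neg_pos)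
  moreover have "w \<bullet> (Im_matrix (N t X) *v w) = - Im S"
  proof -
    have "w \<bullet> (Im_matrix (N t X) *v w) = (\<Sum>i\<in>UNIV. w $ i * Im ((N t X *v w') $ i))"
      by (simp add: inner_vec_def matrix_vector_mult_def Im_matrix_def w'_def)
    also have "\<dots> = Im (\<Sum>i\<in>UNIV. cnj (w' $ i) * (N t X *v w') $ i)"
      by (simp add: w'_def)
    also have "\<dots> = - Im S" by (simp only: Nw S_def Pv) (simp add: sum_negf)
    finally show ?thesis .
  qed
  ultimately show "0 < w \<bullet> (Im_matrix (N t X) *v w)" by simp
qed

text \<open>The forward trajectory of \<open>V\<close> that reaches \<open>X\<close> at time \<open>T\<close>.\<close>

lemma characteristic_deriv:
  assumes "s \<in> {0..T}"
  shows "((\<lambda>s. \<phi> (T - s) X + X0) has_vector_derivative hfield H (\<phi> (T - s) X + X0)) (at s within {0..T})"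
proof -
  have "((\<lambda>t. \<phi> t X + X0) \<circ> (\<lambda>s. T - s) has_vector_derivative
      (- 1) *\<^sub>R (- hfield H (\<phi> (T - s) X + X0))) (at s within {0..T})"
  proof (rule vector_diff_chain_within)
    show "((\<lambda>s. T - s) has_vector_derivative - 1) (at s within {0..T})"
      by (auto intro!: derivative_eq_intros)
    show "((\<lambda>t. \<phi> t X + X0) has_vector_derivative - hfield H (\<phi> (T - s) X + X0))
        (at (T - s) within (\<lambda>s. T - s) ` {0..T})"
      by (rule has_vector_derivative_within_subset[OF flow]) (use assms in auto)
  qed
  then show ?thesis by (simp add: o_def)
qed

lemma deriv_along_characteristic:
  fixes u :: "real \<Rightarrow> 'n phase \<Rightarrow> complex ^ 'n ^ 'n"
  assumes u: "C1_global u" and s: "s \<in> {0..T}"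
  shows "((\<lambda>s. u s (\<phi> (T - s) X + X0)) has_vector_derivative
    liouville H u s (\<phi> (T - s) X + X0)) (at s within {0..T})"
proof -
  define Y where "Y = (\<lambda>s. \<phi> (T - s) X + X0)"
  obtain D where D: "((\<lambda>(t, X). u t X) has_derivative D) (at (s, Y s) within {0..} \<times> UNIV)"
    using C1_global_has_derivative[OF u, of s "Y s"] s by auto
  have Y: "(Y has_derivative (\<lambda>h. h *\<^sub>R hfield H (Y s))) (at s within {0..T})"
    using characteristic_deriv[OF s] by (simp add: Y_def has_vector_derivative_def)
  have "((\<lambda>s. (\<lambda>(t, X). u t X) (s, Y s)) has_derivative (\<lambda>h. D (h, h *\<^sub>R hfield H (Y s)))) (at s within {0..T})"
    by (rule has_derivative_in_compose[where f = "\<lambda>s. (s, Y s)"])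
      (auto intro!: has_derivative_Pair has_derivative_ident Y has_derivative_subset[OF D])
  moreover have "D (h, h *\<^sub>R hfield H (Y s)) = h *\<^sub>R D (1, hfield H (Y s))" for h
    using linear_scale[OF has_derivative_linear[OF D], of h "(1, hfield H (Y s))"] by simp
  moreover have "liouville H u s (Y s) = D (1, hfield H (Y s))"
    using s by (intro liouville_has_derivative[OF D]) auto
  ultimately have "((\<lambda>s. u s (Y s)) has_vector_derivative liouville H u s (Y s)) (at s within {0..T})"
    by (simp only: has_vector_derivative_def split_conv)
  then show ?thesis by (simp only: Y_def)
qed

text \<open>Along the trajectory of \<open>V\<close> ending at \<open>X\<close> at time \<open>T\<close>, the difference of two solutions grows at most
  exponentially, and it starts at \<open>0\<close>.\<close>

lemma riccati_unique:
  assumes M: "solves_riccati H (N 0) M" and T: "0 \<le> T"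
  shows "M T X = N T X"
proof -
  define Y where "Y = (\<lambda>s. \<phi> (T - s) X + X0)"
  define E where "E = (\<lambda>s. M s (Y s) - N s (Y s))"
  define E' where "E' = (\<lambda>s. liouville H M s (Y s) - liouville H N s (Y s))"
  have M_C1: "C1_global M" and M_0: "\<And>X. M 0 X = N 0 X"
    and M_ric: "\<And>t X. 0 \<le> t \<Longrightarrow> liouville H M t X + Hxx H X + Hxp H X ** M t X + M t X ** Hpx H X
      + M t X ** Hpp H X ** M t X = 0"
    using M unfolding solves_riccati_def by blast+
  have dM: "((\<lambda>s. M s (Y s)) has_vector_derivative liouville H M s (Y s)) (at s within {0..T})"
    and dN: "((\<lambda>s. N s (Y s)) has_vector_derivative liouville H N s (Y s)) (at s within {0..T})"
    if "s \<in> {0..T}" for s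
    unfolding Y_def using that by (intro deriv_along_characteristic M_C1 N_C1; simp)+
  have cont_Y: "continuous_on {0..T} Y"
    unfolding Y_def by (rule continuous_on_vector_derivative[OF characteristic_deriv])
  have cont_M: "continuous_on {0..T} (\<lambda>s. M s (Y s))"
    by (rule continuous_on_vector_derivative[OF dM])
  have cont_N: "continuous_on {0..T} (\<lambda>s. N s (Y s))"
    by (rule continuous_on_vector_derivative[OF dN])
  obtain K where K: "0 < K"
    "\<And>(A :: complex ^ 'n ^ 'n) (B :: complex ^ 'n ^ 'n). norm (A ** B) \<le> norm A * norm B * K"
    using matrix_mult.pos_bounded by blast
  define c where "c = (\<lambda>s. K * (norm (Hxp H (Y s)) + norm (Hpx H (Y s))
    + norm (M s (Y s) ** Hpp H (Y s)) + norm (Hpp H (Y s) ** N s (Y s))))"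
  have "continuous_on {0..T} c"
    unfolding c_def
    by (intro continuous_intros matrix_mult.continuous_on cont_Y cont_M cont_N
        continuous_on_compose2[OF continuous_on_Hxp[OF smooth_H]]
        continuous_on_compose2[OF continuous_on_Hpx[OF smooth_H]]
        continuous_on_compose2[OF continuous_on_Hpp[OF smooth_H]]) auto
  then have "\<exists>x\<in>{0..T}. \<forall>y\<in>{0..T}. c y \<le> c x"
    using T by (intro continuous_attains_sup) auto
  then obtain C where C: "\<And>s. s \<in> {0..T} \<Longrightarrow> c s \<le> C" by blast
  have "E T = 0"
  proof (rule gronwall_zero[OF _ _ _ T])
    fix s assume s: "s \<in> {0..T}"
    show "(E has_vector_derivative E' s) (at s within {0..T})"
      unfolding E_def E'_def by (intro has_vector_derivative_diff dM dN s)
    have "E' s = - (Hxp H (Y s) ** E s + E s ** Hpx H (Y s) + (M s (Y s) ** Hpp H (Y s)) ** E s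
        + E s ** (Hpp H (Y s) ** N s (Y s)))"
      unfolding E'_def E_def using s by (intro riccati_difference[where C = "Hxx H (Y s)"] M_ric N_riccati) auto
    then have "norm (E' s) \<le> norm (Hxp H (Y s) ** E s) + norm (E s ** Hpx H (Y s))
        + norm ((M s (Y s) ** Hpp H (Y s)) ** E s) + norm (E s ** (Hpp H (Y s) ** N s (Y s)))"
      by (simp only: norm_minus_cancel) (intro norm_triangle_mono order_refl)
    also have "\<dots> \<le> norm (Hxp H (Y s)) * norm (E s) * K + norm (E s) * norm (Hpx H (Y s)) * K
        + norm (M s (Y s) ** Hpp H (Y s)) * norm (E s) * K
        + norm (E s) * norm (Hpp H (Y s) ** N s (Y s)) * K"
      by (intro add_mono K)
    also have "\<dots> = c s * norm (E s)" by (simp add: c_def algebra_simps)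
    also have "\<dots> \<le> C * norm (E s)" by (intro mult_right_mono C s) simp
    finally show "norm (E' s) \<le> C * norm (E s)" .
  qed (simp add: E_def M_0)
  then show ?thesis
    by (simp only: E_def Y_def diff_self \<phi>_init diff_add_cancel right_minus_eq)
qed

end

end

theorem theorem7p1:
  fixes H :: "'n::finite phase \<Rightarrow> real"
    and X0 :: "'n phase"
    and \<phi> :: "real \<Rightarrow> 'n phase \<Rightarrow> 'n phase"
    and k1 k2 :: complex
  assumes "smooth H"
    and "solves_liouville H \<phi>"
    and "\<And>X. \<phi> 0 X = X - X0"
  defines "g \<equiv> comb k1 k2 \<phi>"
  defines "N \<equiv> (\<lambda>t X. - (grad_x (g t) X ** matrix_inv (grad_p (g t) X)))"
  shows
    "solves_liouville H g
     \<and> (Im (cnj k1 * k2) \<noteq> 0 \<longrightarrow>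
          (\<forall>t>0. \<forall>X. invertible (grad_p (g t) X))
        \<and> (\<forall>M. solves_riccati H (N 0) M \<longrightarrow> (\<forall>t>0. \<forall>X. M t X = N t X))
        \<and> solves_riccati H (N 0) N
        \<and> (\<forall>t\<ge>0. \<forall>X. N t X = transpose (N t X))
        \<and> (Im (k1 / k2) < 0 \<longrightarrow> (\<forall>t>0. \<forall>X. positive_definite (Im_matrix (N t X)))))"
proof -
  obtain G V' where G:
    "\<And>t X. 0 \<le> t \<Longrightarrow> (\<phi> t has_derivative blinfun_apply (G t X)) (at X)"
    "\<And>t X u v. 0 \<le> t \<Longrightarrow> (\<Sum>b\<in>Basis. (G t X b \<bullet> u) * (G t X (phase_J b) \<bullet> v)) = phase_J u \<bullet> v"
    "\<And>w e. C1_global (\<lambda>t X. G t X w \<bullet> e)"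
    "\<And>t X w e. 0 \<le> t \<Longrightarrow> liouville H (\<lambda>t X. G t X w \<bullet> e) t X = - (G t X (blinfun_apply (V' X) w) \<bullet> e)"
    "\<And>X. (hfield H has_derivative blinfun_apply (V' X)) (at X)"
    "\<And>t X. 0 \<le> t \<Longrightarrow>
      ((\<lambda>t. \<phi> t X + X0) has_vector_derivative - hfield H (\<phi> t X + X0)) (at t within {0..})"
    by (rule liouville_jacobian[OF assms(1-3)]) (rule that)
  interpret liouville_solution H X0 \<phi> G V' k1 k2
    by (rule liouville_solution.intro) (fact assms(1-3) G)+
  have N: "N = (\<lambda>t X. - (grad_x (g t) X ** matrix_inv (grad_p (g t) X)))" by (simp add: N_def)
  show ?thesis
  proof (intro conjI impI allI)
    show "solves_liouville H g" unfolding g_def by (rule g_solves)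
    assume k: "Im (cnj k1 * k2) \<noteq> 0"
    show "invertible (grad_p (g t) X)" if "0 < t" for t X
      unfolding g_def using that by (intro P_invertible k) simp
    show "M t X = N t X" if "solves_riccati H (N 0) M" "0 < t" for M t X
      using riccati_unique[OF k, of M t X] that unfolding N g_def by simp
    show "solves_riccati H (N 0) N" unfolding N g_def by (rule N_solves[OF k])
    show "N t X = transpose (N t X)" if "0 \<le> t" for t X
      using N_symmetric[OF k that, of X] unfolding N g_def by simp
    show "positive_definite (Im_matrix (N t X))" if "Im (k1 / k2) < 0" "0 < t" for t X
      using N_pos[OF k, of t X] that unfolding N g_def by simp
  qed
qed

end
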